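(* (Strong Collection.) In the v-set interpretation: let $\psi(a,b)$ be an arbitrary binary relation (any formula of the ambient system, not necessarily a set) and $x$ a set such that every element $a$ of $x$ has at least one set $b$ with $\psi(a,b)$. Then there is a set $y$ such that every element $a$ of $x$ has some $b\in y$ with $\psi(a,b)$, and every element $b$ of $y$ has some $a\in x$ with $\psi(a,b)$.
   Context: Work in Heyting arithmetic extended by unary predicates $\mathcal V$ ("v-set"), $\mathcal M$ ("Meaningful condition"), $\mathcal T$ ("True condition"). $\langle\cdot,\cdot\rangle$ is Cantor pairing with projections $(\cdot)_L,(\cdot)_R$; $en$ is Kleene application, $en\!\downarrow$ means it is defined. Write $\mathrm{cd}_x(n)=(xn)_R$, $\mathrm{el}_x(n)=(xn)_L$. $\Xi(f,g)$ is a fixed primitive recursive injective coding of pairs. Axioms: (V1) $\forall x\,[\forall n\,(xn\!\downarrow\wedge\mathcal M(\mathrm{cd}_x(n))\wedge(\mathcal T(\mathrm{cd}_x(n))\to\mathcal V(\mathrm{el}_x(n))))]\to\mathcal V(x)$; (V2) for every formula $\phi$: if the antecedent of (V1) with $\mathcal V$ replaced by $\phi$ implies $\phi(x)$ for all $x$, then $\forall x(\mathcal V(x)\to\phi(x))$; (X1) $\mathcal M(\Xi(f,g))\to(\mathcal T(\Xi(f,g))\leftrightarrow\forall n(fn\!\downarrow\wedge\mathcal T(fn)\to gn\!\downarrow\wedge\mathcal T(gn)))$; (X2) if $\forall n(fn\!\downarrow\to\mathcal M(fn))$ and $\forall n(fn\!\downarrow\wedge gn\!\downarrow\wedge\mathcal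 T(fn)\to\mathcal M(gn))$ then $\mathcal M(\Xi(f,g))$; ($\mathsf{ECT}_V$) $(\forall n(\phi(n)\to\exists m\,\psi(n,m)))\to\exists e\,\forall n(\phi(n)\to en\!\downarrow\wedge\psi(n,en))$ for arbitrary $\psi$ and almost-negative $\phi$ (built from $\Sigma_1$ formulas and atoms $\mathcal V(t),\mathcal M(t),\mathcal T(t)$ by $\wedge,\to,\forall_{\mathbb N}$). Sets are interpreted as v-sets (numbers $x$ with $\mathcal V(x)$); $EL(x)=\{\mathrm{el}_x(n):\mathcal T(\mathrm{cd}_x(n))\}$. Set equality is extensional equality $\simeq$ of v-sets, characterized by $x\simeq y\iff(\forall a\in EL(x)\exists b\in EL(y)\,a\simeq b)\wedge(\forall b\in EL(y)\exists a\in EL(x)\,b\simeq a)$. Unbounded set quantifiers range over v-sets, bounded quantifiers range over $EL(x)$, and $x\in y$ means $\exists y'\in EL(y)\,x\simeq y'$. A set-theoretic statement holds in the v-set interpretation if its interpretation is provable in this system. *)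

theory Defs
  imports "HOL-Library.Nat_Bijection"
begin

section \<open>Primitive recursive functions\<close>

text \<open>
  Symbols carry no arity: a symbol stands for one primitive recursive function of each
  arity, arguments that are missing being read as 0.  The recursion argument of
  \<open>PRec\<close> comes first.
\<close>

datatype pfun = PZero | PSucc | PProj nat | PComp pfun "pfun list" | PRec pfun pfun

definition arg :: "'a \<Rightarrow> nat \<Rightarrow> 'a list \<Rightarrow> 'a" where
  "arg z i xs = (if i < length xs then xs ! i else z)"

primrec pr_eval :: "pfun \<Rightarrow> nat list \<Rightarrow> nat" where
  "pr_eval PZero = (\<lambda>xs. 0)"
| "pr_eval PSucc = (\<lambda>xs. Suc (arg 0 0 xs))"
| "pr_eval (PProj i) = (\<lambda>xs. arg 0 i xs)"
| "pr_eval (PComp f gs) = (\<lambda>xs. pr_eval f (map (\<lambda>h. h xs) (map pr_eval gs)))"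
| "pr_eval (PRec f g) =
     (\<lambda>xs. rec_nat (pr_eval f (tl xs)) (\<lambda>n r. pr_eval g (n # r # tl xs)) (arg 0 0 xs))"

abbreviation "pr_S a \<equiv> PComp PSucc [a]"

definition pr_add :: pfun where
  "pr_add = PRec (PProj 0) (pr_S (PProj 1))"
definition pr_pred :: pfun where
  "pr_pred = PRec PZero (PProj 0)"
definition pr_bus :: pfun where \<comment> \<open>\<open>(m, n) \<mapsto> n - m\<close>\<close>
  "pr_bus = PRec (PProj 0) (PComp pr_pred [PProj 1])"
definition pr_sub :: pfun where
  "pr_sub = PComp pr_bus [PProj 1, PProj 0]"
definition pr_dist :: pfun where
  "pr_dist = PComp pr_add [pr_sub, pr_bus]"
definition pr_ifz :: pfun where \<comment> \<open>\<open>(c, a, b) \<mapsto> if c = 0 then a else b\<close>\<close>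
  "pr_ifz = PRec (PProj 0) (PProj 3)"
definition pr_tri :: pfun where
  "pr_tri = PRec PZero (PComp pr_add [PProj 1, pr_S (PProj 0)])"
definition pr_root :: pfun where \<comment> \<open>the largest \<open>k\<close> with \<open>triangle k \<le> n\<close>\<close>
  "pr_root = PRec PZero
     (PComp pr_ifz [PComp pr_dist [pr_S (PProj 0), PComp pr_tri [pr_S (PProj 1)]],
        pr_S (PProj 1), PProj 1])"

text \<open>Cantor pairing and its projections.\<close>

definition pr_pair :: pfun where
  "pr_pair = PComp pr_add [PComp pr_tri [pr_add], PProj 0]"
definition pr_L :: pfun where
  "pr_L = PComp pr_sub [PProj 0, PComp pr_tri [pr_root]]"
definition pr_R :: pfun where
  "pr_R = PComp pr_sub [pr_root, pr_L]"

section \<open>Kleene application\<close>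

text \<open>
  A number \<open>\<langle>tag, d\<rangle>\<close> is read as an index of a unary partial recursive function:
  tags 0 to 7 are zero, successor, left, right, composition, pairing, primitive recursion
  and minimization; tags 8 to 10 are needed for intermediate states of a computation; all
  other tags give the nowhere defined function.  A state \<open>\<langle>v, K\<rangle>\<close> of the evaluator
  holds the current value \<open>v\<close> and a stack \<open>K\<close> of indices that remain to be applied, where
  \<open>0\<close> is the empty stack and \<open>Suc \<langle>c, K\<rangle>\<close> is \<open>K\<close> with \<open>c\<close> on top.  The evaluator has
  halted when the stack is empty.  The function computed by each index is spelled out by
  \<open>kleene\<close> and \<open>kleene_app_adequate\<close> below.
\<close>

abbreviation "pr_l a \<equiv> PComp pr_L [a]"
abbreviation "pr_r a \<equiv> PComp pr_R [a]"
abbreviation "pr_p a b \<equiv> PComp pr_pair [a, b]"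
abbreviation "pr_if c a b \<equiv> PComp pr_ifz [c, a, b]"
abbreviation "pr_push c k \<equiv> pr_S (pr_p c k)"

fun pr_num :: "nat \<Rightarrow> pfun" where
  "pr_num 0 = PZero"
| "pr_num (Suc n) = pr_S (pr_num n)"

fun pr_switch :: "pfun \<Rightarrow> pfun list \<Rightarrow> pfun \<Rightarrow> pfun" where
  "pr_switch t [] b = b"
| "pr_switch t (a # as) b = pr_if t a (pr_switch (PComp pr_pred [t]) as b)"

definition pr_step :: pfun where
  "pr_step =
    (let st = PProj 0;
         v = pr_l st; top = PComp pr_pred [pr_r st];
         c = pr_l top; K = pr_r top;
         tag = pr_l c; d = pr_r c; f = pr_l d; g = pr_r d;
         prev = pr_p (pr_l v) (PComp pr_pred [pr_r v]);
         start = pr_p v PZero;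
         next = pr_p (pr_l g) (pr_S (pr_r g));
         test = (\<lambda>h q. pr_p (pr_num 10) (pr_p h q))
     in pr_if (pr_r st) st
       (pr_switch tag
         [ pr_p PZero K,
           pr_p (pr_S v) K,
           pr_p (pr_l v) K,
           pr_p (pr_r v) K,
           pr_p v (pr_push g (pr_push f K)),
           pr_p v (pr_push f (pr_push (pr_p (pr_num 9) (pr_p g v)) K)),
           pr_if (pr_r v)
             (pr_p (pr_l v) (pr_push f K))
             (pr_p prev (pr_push c (pr_push (pr_p (pr_num 8) prev) (pr_push g K)))),
           pr_p start (pr_push d (pr_push (test d start) K)),
           pr_p (pr_p d v) K,
           pr_p g (pr_push f (pr_push (pr_p (pr_num 8) v) K)),
           pr_if v
             (pr_p (pr_r g) K)
             (pr_p next (pr_push f (pr_push (test f next) K))) ]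
         st))"

definition pr_state :: pfun where \<comment> \<open>\<open>(s, e, n) \<mapsto>\<close> the state reached after \<open>s\<close> steps of \<open>e n\<close>\<close>
  "pr_state = PRec (pr_p (PProj 1) (pr_push (PProj 0) PZero)) (PComp pr_step [PProj 1])"

text \<open>\<open>(s, e, n) \<mapsto> Suc m\<close> if \<open>e n\<close> has halted with value \<open>m\<close> after \<open>s\<close> steps, and \<open>0\<close> if it
  has not halted.\<close>

definition pr_run :: pfun where
  "pr_run = pr_if (pr_r pr_state) (pr_S (pr_l pr_state)) PZero"

text \<open>The same notion in the metalanguage.  It is not used by the formal system.\<close>

inductive kleene :: "nat \<Rightarrow> nat \<Rightarrow> nat \<Rightarrow> bool" where
  zero: "kleene (prod_encode (0, d)) n 0"
| succ: "kleene (prod_encode (1, d)) n (Suc n)"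
| left: "kleene (prod_encode (2, d)) (prod_encode (a, b)) a"
| right: "kleene (prod_encode (3, d)) (prod_encode (a, b)) b"
| comp: "kleene g n k \<Longrightarrow> kleene f k m \<Longrightarrow>
    kleene (prod_encode (4, prod_encode (f, g))) n m"
| pair: "kleene f n k \<Longrightarrow> kleene (prod_encode (9, prod_encode (g, n))) k m \<Longrightarrow>
    kleene (prod_encode (5, prod_encode (f, g))) n m"
| rec_0: "kleene f p m \<Longrightarrow>
    kleene (prod_encode (6, prod_encode (f, g))) (prod_encode (p, 0)) m"
| rec_Suc: "kleene (prod_encode (6, prod_encode (f, g))) (prod_encode (p, k)) r \<Longrightarrow>
    kleene g (prod_encode (prod_encode (p, k), r)) m \<Longrightarrow>
    kleene (prod_encode (6, prod_encode (f, g))) (prod_encode (p, Suc k)) m"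
| mu: "kleene f (prod_encode (n, 0)) r \<Longrightarrow>
    kleene (prod_encode (10, prod_encode (f, prod_encode (n, 0)))) r m \<Longrightarrow>
    kleene (prod_encode (7, f)) n m"
| cons: "kleene (prod_encode (8, w)) n (prod_encode (w, n))"
| pair_snd: "kleene g u m \<Longrightarrow>
    kleene (prod_encode (9, prod_encode (g, u))) v (prod_encode (v, m))"
| mu_stop: "kleene (prod_encode (10, prod_encode (f, prod_encode (n, k)))) 0 k"
| mu_next: "kleene f (prod_encode (n, Suc k)) r \<Longrightarrow>
    kleene (prod_encode (10, prod_encode (f, prod_encode (n, Suc k)))) r m \<Longrightarrow>
    kleene (prod_encode (10, prod_encode (f, prod_encode (n, k)))) (Suc v) m"

subsection \<open>Adequacy\<close>

lemma arg_simps [simp]: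
  "arg z i [] = z" "arg z 0 (x # xs) = x" "arg z (Suc i) (x # xs) = arg z i xs"
  by (auto simp: arg_def)

lemma arg_numeral [simp]: "arg z (numeral k) (x # xs) = arg z (pred_numeral k) xs"
  by (simp add: numeral_eq_Suc)

lemma eval_add [simp]: "pr_eval pr_add (a # b # xs) = a + b"
  by (induct a) (simp_all add: pr_add_def)
lemma eval_pred [simp]: "pr_eval pr_pred (a # xs) = a - 1"
  by (cases a) (simp_all add: pr_pred_def)
lemma eval_bus [simp]: "pr_eval pr_bus (a # b # xs) = b - a"
  by (induct a) (simp_all add: pr_bus_def)
lemma eval_sub [simp]: "pr_eval pr_sub (a # b # xs) = a - b"
  by (simp add: pr_sub_def)
lemma eval_dist [simp]: "pr_eval pr_dist (a # b # xs) = (a - b) + (b - a)"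
  by (simp add: pr_dist_def)
lemma eval_ifz [simp]: "pr_eval pr_ifz (c # a # b # xs) = (if c = 0 then a else b)"
  by (cases c) (simp_all add: pr_ifz_def)
lemma eval_tri [simp]: "pr_eval pr_tri (a # xs) = triangle a"
  by (induct a) (simp_all add: pr_tri_def)

lemma eval_pair [simp]: "pr_eval pr_pair (a # b # xs) = prod_encode (a, b)"
  by (simp add: pr_pair_def prod_encode_def)

lemma eval_root_0: "pr_eval pr_root (0 # xs) = 0"
  by (simp add: pr_root_def)

lemma eval_root_Suc: "pr_eval pr_root (Suc n # xs) =
  (let r = pr_eval pr_root (n # xs) in if Suc n = triangle (Suc r) then Suc r else r)"
  by (auto simp: pr_root_def Let_def cong: if_cong)

lemma eval_root_aux: "a \<le> k \<Longrightarrow> pr_eval pr_root ((triangle k + a) # xs) = k"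
proof (induct k arbitrary: a)
  case 0
  then show ?case by (simp add: eval_root_0)
next
  case (Suc k)
  have base: "pr_eval pr_root (triangle (Suc k) # xs) = Suc k"
    using Suc.hyps[of k] by (simp add: eval_root_Suc Let_def)
  show ?case using Suc.prems
    by (induct a) (use base in \<open>simp_all add: eval_root_Suc Let_def\<close>)
qed

lemma eval_L_pair: "pr_eval pr_L (prod_encode (a, b) # xs) = a"
  and eval_R_pair: "pr_eval pr_R (prod_encode (a, b) # xs) = b"
  by (simp_all add: pr_R_def pr_L_def prod_encode_def eval_root_aux)

lemma eval_L [simp]: "pr_eval pr_L (n # xs) = fst (prod_decode n)"
  and eval_R [simp]: "pr_eval pr_R (n # xs) = snd (prod_decode n)"
  using eval_L_pair[of "fst (prod_decode n)" "snd (prod_decode n)"]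
    eval_R_pair[of "fst (prod_decode n)" "snd (prod_decode n)"] by simp_all

lemma eval_num [simp]: "pr_eval (pr_num n) xs = n"
  by (induct n) simp_all

lemma eval_switch [simp]: "pr_eval (pr_switch t as b) xs =
  (if pr_eval t xs < length as then pr_eval (as ! pr_eval t xs) xs else pr_eval b xs)"
proof (induct as arbitrary: t)
  case (Cons a as)
  then show ?case by (cases "pr_eval t xs") auto
qed simp

abbreviation push :: "nat \<Rightarrow> nat \<Rightarrow> nat" where
  "push c K \<equiv> Suc (prod_encode (c, K))"

definition kstep :: "nat \<Rightarrow> nat" where
  "kstep st = pr_eval pr_step [st]"

lemmas kstep_simps = kstep_def pr_step_def Let_def numeral_eq_Suc

lemma kstep_halted: "kstep (prod_encode (v, 0)) = prod_encode (v, 0)"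
  by (simp add: kstep_simps)

lemma kstep_zero: "kstep (prod_encode (v, push (prod_encode (0, d)) K)) = prod_encode (0, K)"
  and kstep_succ: "kstep (prod_encode (v, push (prod_encode (1, d)) K)) = prod_encode (Suc v, K)"
  and kstep_left: "kstep (prod_encode (prod_encode (a, b), push (prod_encode (2, d)) K)) =
    prod_encode (a, K)"
  and kstep_right: "kstep (prod_encode (prod_encode (a, b), push (prod_encode (3, d)) K)) =
    prod_encode (b, K)"
  and kstep_comp: "kstep (prod_encode (v, push (prod_encode (4, prod_encode (f, g))) K)) =
    prod_encode (v, push g (push f K))"
  and kstep_pair: "kstep (prod_encode (v, push (prod_encode (5, prod_encode (f, g))) K)) =
    prod_encode (v, push f (push (prod_encode (9, prod_encode (g, v))) K))"
  and kstep_rec_0: "kstep (prod_encode (prod_encode (p, 0), push (prod_encode (6, prod_encode (f, g))) K)) =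
    prod_encode (p, push f K)"
  and kstep_rec_Suc: "kstep (prod_encode (prod_encode (p, Suc k), push (prod_encode (6, prod_encode (f, g))) K)) =
    prod_encode (prod_encode (p, k), push (prod_encode (6, prod_encode (f, g)))
      (push (prod_encode (8, prod_encode (p, k))) (push g K)))"
  and kstep_mu: "kstep (prod_encode (v, push (prod_encode (7, f)) K)) =
    prod_encode (prod_encode (v, 0), push f
      (push (prod_encode (10, prod_encode (f, prod_encode (v, 0)))) K))"
  and kstep_cons: "kstep (prod_encode (v, push (prod_encode (8, d)) K)) =
    prod_encode (prod_encode (d, v), K)"
  and kstep_pair_snd: "kstep (prod_encode (v, push (prod_encode (9, prod_encode (g, u))) K)) =
    prod_encode (u, push g (push (prod_encode (8, v)) K))"
  and kstep_mu_stop: "kstep (prod_encode (0, push (prod_encode (10, prod_encode (f, prod_encode (n, k)))) K)) =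
    prod_encode (k, K)"
  and kstep_mu_next: "kstep (prod_encode (Suc v, push (prod_encode (10, prod_encode (f, prod_encode (n, k)))) K)) =
    prod_encode (prod_encode (n, Suc k), push f
      (push (prod_encode (10, prod_encode (f, prod_encode (n, Suc k)))) K))"
  and kstep_else: "t > 10 \<Longrightarrow> kstep (prod_encode (v, push (prod_encode (t, d)) K)) =
    prod_encode (v, push (prod_encode (t, d)) K)"
  by (simp_all add: kstep_simps)

lemma kleene_imp_steps:
  "kleene c v u \<Longrightarrow> \<exists>s. (kstep ^^ s) (prod_encode (v, push c K)) = prod_encode (u, K)"
proof (induct arbitrary: K rule: kleene.induct)
  have one: "\<exists>s. (kstep ^^ s) a = b" if "kstep a = b" for a b
    using that by (intro exI[of _ 1]) simp
  have step: "\<exists>s. (kstep ^^ s) a = c" if "kstep a = b" "\<exists>s. (kstep ^^ s) b = c" for a b c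
  proof -
    from that obtain s where "(kstep ^^ s) (kstep a) = c" by blast
    then have "(kstep ^^ Suc s) a = c" by (simp only: funpow_Suc_right o_def)
    then show ?thesis by blast
  qed
  have trans: "\<exists>s. (kstep ^^ s) a = c"
    if "\<exists>s. (kstep ^^ s) a = b" "\<exists>s. (kstep ^^ s) b = c" for a b c
    using that by (metis funpow_add o_apply)
  {
    case zero show ?case by (rule one) (rule kstep_zero)
  next
    case succ show ?case by (rule one) (rule kstep_succ)
  next
    case left show ?case by (rule one) (rule kstep_left)
  next
    case right show ?case by (rule one) (rule kstep_right)
  next
    case comp then show ?case by (blast intro: step[OF kstep_comp] trans)
  next
    case pair then show ?case by (blast intro: step[OF kstep_pair] trans)
  next
    case rec_0 then show ?case by (blast intro: step[OF kstep_rec_0])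
  next
    case (rec_Suc f g p k r m)
    show ?case
      by (rule step[OF kstep_rec_Suc], rule trans[OF rec_Suc(2)], rule step[OF kstep_cons],
          rule rec_Suc(4))
  next
    case mu then show ?case by (blast intro: step[OF kstep_mu] trans)
  next
    case cons show ?case by (rule one) (rule kstep_cons)
  next
    case pair_snd
    then show ?case by (blast intro: step[OF kstep_pair_snd] trans one[OF kstep_cons])
  next
    case mu_stop show ?case by (rule one) (rule kstep_mu_stop)
  next
    case mu_next then show ?case by (blast intro: step[OF kstep_mu_next] trans)
  }
qed

lemma steps_imp_kleene:
  "(kstep ^^ s) (prod_encode (v, push c K)) = prod_encode (m, 0) \<Longrightarrow>
    \<exists>u s'. s' < s \<and> kleene c v u \<and> (kstep ^^ s') (prod_encode (u, K)) = prod_encode (m, 0)"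
proof (induct s arbitrary: v c K rule: less_induct)
  case (less s)
  obtain t where s: "s = Suc t"
    using less.prems by (cases s) auto
  obtain tag d where c: "c = prod_encode (tag, d)"
    by (metis prod_decode_inverse surj_pair)
  obtain f g where d: "d = prod_encode (f, g)"
    by (metis prod_decode_inverse surj_pair)
  obtain n k where g: "g = prod_encode (n, k)"
    by (metis prod_decode_inverse surj_pair)
  obtain a b where v: "v = prod_encode (a, b)"
    by (metis prod_decode_inverse surj_pair)
  have run: "(kstep ^^ t) (kstep (prod_encode (v, push c K))) = prod_encode (m, 0)"
    using less.prems by (simp only: s funpow_Suc_right o_def)
  have IH: "\<exists>u s'. s' < r \<and> kleene c v u \<and> (kstep ^^ s') (prod_encode (u, K)) = prod_encode (m, 0)"
    if "r \<le> t" "(kstep ^^ r) (prod_encode (v, push c K)) = prod_encode (m, 0)" for r c v K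
    using less.hyps[of r v c K] that s by auto
  have IH2: "\<exists>u1 u2 s'. s' < t \<and> kleene c1 w u1 \<and> kleene c2 u1 u2 \<and>
      (kstep ^^ s') (prod_encode (u2, K)) = prod_encode (m, 0)"
    if "(kstep ^^ t) (prod_encode (w, push c1 (push c2 K))) = prod_encode (m, 0)" for c1 c2 w K
    using IH[OF order_refl that] IH by (metis less_imp_le less_trans)
  have fin: ?case if "r \<le> t" "kleene c v u" "(kstep ^^ r) (prod_encode (u, K)) = prod_encode (m, 0)" for r u
    using that unfolding s by (metis le_imp_less_Suc)
  have "tag = 0 \<or> tag = 1 \<or> tag = 2 \<or> tag = 3 \<or> tag = 4 \<or> tag = 5 \<or> tag = 6 \<or>
      tag = 7 \<or> tag = 8 \<or> tag = 9 \<or> tag = 10 \<or> tag > 10"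
    by arith
  then consider "tag = 0" | "tag = 1" | "tag = 2" | "tag = 3" | "tag = 4" | "tag = 5" | "tag = 6"
    | "tag = 7" | "tag = 8" | "tag = 9" | "tag = 10" | "tag > 10"
    by blast
  then show ?case
  proof cases
    case 1
    from run have "(kstep ^^ t) (prod_encode (0, K)) = prod_encode (m, 0)"
      by (simp only: c 1 kstep_zero)
    moreover have "kleene c v (0)"
      unfolding c 1 by (rule kleene.zero)
    ultimately show ?thesis by (rule fin[OF order_refl, rotated])
  next
    case 2
    from run have "(kstep ^^ t) (prod_encode (Suc v, K)) = prod_encode (m, 0)"
      by (simp only: c 2 kstep_succ)
    moreover have "kleene c v (Suc v)"
      unfolding c 2 by (rule kleene.succ)
    ultimately show ?thesis by (rule fin[OF order_refl, rotated])
  next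
    case 3
    from run have "(kstep ^^ t) (prod_encode (a, K)) = prod_encode (m, 0)"
      by (simp only: c v 3 kstep_left)
    moreover have "kleene c v (a)"
      unfolding c v 3 by (rule kleene.left)
    ultimately show ?thesis by (rule fin[OF order_refl, rotated])
  next
    case 4
    from run have "(kstep ^^ t) (prod_encode (b, K)) = prod_encode (m, 0)"
      by (simp only: c v 4 kstep_right)
    moreover have "kleene c v (b)"
      unfolding c v 4 by (rule kleene.right)
    ultimately show ?thesis by (rule fin[OF order_refl, rotated])
  next
    case 5
    from run have "(kstep ^^ t) (prod_encode (v, push (g) (push (f) K))) = prod_encode (m, 0)"
      by (simp only: c d 5 kstep_comp)
    from IH2[OF this] obtain u1 u2 s' where s': "s' < t" "kleene (g) (v) u1"
        "kleene (f) u1 u2" "(kstep ^^ s') (prod_encode (u2, K)) = prod_encode (m, 0)"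
      by blast
    have "kleene c v u2"
      unfolding c d 5 using s'(2,3) by (rule kleene.comp)
    with s' show ?thesis by (intro fin[of s' u2]) simp_all
  next
    case 6
    from run have "(kstep ^^ t) (prod_encode (v, push (f) (push (prod_encode (9, prod_encode (g, v))) K))) = prod_encode (m, 0)"
      by (simp only: c d 6 kstep_pair)
    from IH2[OF this] obtain u1 u2 s' where s': "s' < t" "kleene (f) (v) u1"
        "kleene (prod_encode (9, prod_encode (g, v))) u1 u2" "(kstep ^^ s') (prod_encode (u2, K)) = prod_encode (m, 0)"
      by blast
    have "kleene c v u2"
      unfolding c d 6 using s'(2,3) by (rule kleene.pair)
    with s' show ?thesis by (intro fin[of s' u2]) simp_all
  next
    case 7
    show ?thesis
    proof (cases b)
      case 0
      from run have "(kstep ^^ t) (prod_encode (a, push f K)) = prod_encode (m, 0)"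
        by (simp only: c d v 7 0 kstep_rec_0)
      from IH[OF order_refl this] obtain u s' where s': "s' < t" "kleene f a u"
          "(kstep ^^ s') (prod_encode (u, K)) = prod_encode (m, 0)"
        by blast
      have "kleene c v u"
        unfolding c d v 7 0 using s'(2) by (rule kleene.rec_0)
      with s' show ?thesis by (intro fin[of s' u]) simp_all
    next
      case (Suc l)
      let ?q = "prod_encode (a, l)"
      from run have "(kstep ^^ t) (prod_encode (?q, push c (push (prod_encode (8, ?q)) (push g K)))) =
          prod_encode (m, 0)"
        by (simp only: c d v 7 Suc kstep_rec_Suc)
      from IH2[OF this] obtain u1 u2 s1 where 1: "s1 < t" "kleene c ?q u1"
          "kleene (prod_encode (8, ?q)) u1 u2"
          "(kstep ^^ s1) (prod_encode (u2, push g K)) = prod_encode (m, 0)"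
        by blast
      from 1(3) have u2: "u2 = prod_encode (?q, u1)"
        by (cases rule: kleene.cases) auto
      from IH[OF less_imp_le[OF 1(1)] 1(4)] obtain u s' where s': "s' < s1" "kleene g u2 u"
          "(kstep ^^ s') (prod_encode (u, K)) = prod_encode (m, 0)"
        by blast
      have "kleene c v u"
        using 1(2) s'(2) unfolding c d v 7 Suc u2 by (rule kleene.rec_Suc)
      with s' 1(1) show ?thesis by (intro fin[of s' u]) simp_all
    qed
  next
    case 8
    from run have "(kstep ^^ t) (prod_encode (prod_encode (v, 0), push (d) (push (prod_encode (10, prod_encode (d, prod_encode (v, 0)))) K))) = prod_encode (m, 0)"
      by (simp only: c 8 kstep_mu)
    from IH2[OF this] obtain u1 u2 s' where s': "s' < t" "kleene (d) (prod_encode (v, 0)) u1"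
        "kleene (prod_encode (10, prod_encode (d, prod_encode (v, 0)))) u1 u2" "(kstep ^^ s') (prod_encode (u2, K)) = prod_encode (m, 0)"
      by blast
    have "kleene c v u2"
      unfolding c 8 using s'(2,3) by (rule kleene.mu)
    with s' show ?thesis by (intro fin[of s' u2]) simp_all
  next
    case 9
    from run have "(kstep ^^ t) (prod_encode (prod_encode (d, v), K)) = prod_encode (m, 0)"
      by (simp only: c 9 kstep_cons)
    moreover have "kleene c v (prod_encode (d, v))"
      unfolding c 9 by (rule kleene.cons)
    ultimately show ?thesis by (rule fin[OF order_refl, rotated])
  next
    case 10
    from run have "(kstep ^^ t) (prod_encode (g, push f (push (prod_encode (8, v)) K))) = prod_encode (m, 0)"
      by (simp only: c d 10 kstep_pair_snd)
    from IH2[OF this] obtain u1 u2 s' where s': "s' < t" "kleene f g u1"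
        "kleene (prod_encode (8, v)) u1 u2" "(kstep ^^ s') (prod_encode (u2, K)) = prod_encode (m, 0)"
      by blast
    from s'(3) have u2: "u2 = prod_encode (v, u1)"
      by (cases rule: kleene.cases) auto
    have "kleene c v u2"
      unfolding c d 10 u2 using s'(2) by (rule kleene.pair_snd)
    with s' show ?thesis by (intro fin[of s' u2]) simp_all
  next
    case 11
    show ?thesis
    proof (cases v)
      case 0
      from run have "(kstep ^^ t) (prod_encode (k, K)) = prod_encode (m, 0)"
        by (simp only: c d g 11 0 kstep_mu_stop)
      moreover have "kleene c v k"
        unfolding c d g 11 0 by (rule kleene.mu_stop)
      ultimately show ?thesis by (rule fin[OF order_refl, rotated])
    next
      case (Suc w)
      from run have "(kstep ^^ t) (prod_encode (prod_encode (n, Suc k), push (f) (push (prod_encode (10, prod_encode (f, prod_encode (n, Suc k)))) K))) = prod_encode (m, 0)"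
        by (simp only: c d g 11 Suc kstep_mu_next)
      from IH2[OF this] obtain u1 u2 s' where s': "s' < t" "kleene (f) (prod_encode (n, Suc k)) u1"
          "kleene (prod_encode (10, prod_encode (f, prod_encode (n, Suc k)))) u1 u2" "(kstep ^^ s') (prod_encode (u2, K)) = prod_encode (m, 0)"
        by blast
      have "kleene c v u2"
        unfolding c d g 11 Suc using s'(2,3) by (rule kleene.mu_next)
      with s' show ?thesis by (intro fin[of s' u2]) simp_all
    qed
  next
    case 12
    from run have "(kstep ^^ t) (prod_encode (v, push c K)) = prod_encode (m, 0)"
      by (simp only: c kstep_else[OF 12])
    from IH[OF order_refl this] obtain u s' where s': "s' < t" "kleene c v u"
        "(kstep ^^ s') (prod_encode (u, K)) = prod_encode (m, 0)"
      by blast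
    then show ?thesis by (intro fin[of s' u]) simp_all
  qed
qed

lemma eval_state: "pr_eval pr_state [s, e, n] = (kstep ^^ s) (prod_encode (n, push e 0))"
  by (induct s) (simp_all add: pr_state_def kstep_def)

theorem kleene_app_adequate: "(\<exists>s. pr_eval pr_run [s, e, n] = Suc m) \<longleftrightarrow> kleene e n m"
proof -
  have run: "pr_eval pr_run [s, e, n] = Suc m \<longleftrightarrow>
      (kstep ^^ s) (prod_encode (n, push e 0)) = prod_encode (m, 0)" for s
  proof -
    obtain a b where ab: "(kstep ^^ s) (prod_encode (n, push e 0)) = prod_encode (a, b)"
      by (metis prod_decode_inverse surj_pair)
    show ?thesis by (simp add: pr_run_def eval_state ab)
  qed
  have halted: "(kstep ^^ s) (prod_encode (u, 0)) = prod_encode (u, 0)" for s u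
    by (induct s) (simp_all add: kstep_halted)
  show ?thesis
  proof
    assume "\<exists>s. pr_eval pr_run [s, e, n] = Suc m"
    then obtain s where "(kstep ^^ s) (prod_encode (n, push e 0)) = prod_encode (m, 0)"
      unfolding run by blast
    from steps_imp_kleene[OF this] show "kleene e n m"
      by (auto simp: halted)
  next
    assume "kleene e n m"
    from kleene_imp_steps[OF this] show "\<exists>s. pr_eval pr_run [s, e, n] = Suc m"
      unfolding run .
  qed
qed

lemma kleene_pair_iff:
  "kleene (prod_encode (5, prod_encode (f, g))) n m \<longleftrightarrow>
    (\<exists>a b. kleene f n a \<and> kleene g n b \<and> m = prod_encode (a, b))"
proof
  assume "kleene (prod_encode (5, prod_encode (f, g))) n m"
  then obtain k where k: "kleene f n k" "kleene (prod_encode (9, prod_encode (g, n))) k m"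
    by (cases rule: kleene.cases) auto
  from k(2) obtain b where "kleene g n b" "m = prod_encode (k, b)"
    by (cases rule: kleene.cases) auto
  with k(1) show "\<exists>a b. kleene f n a \<and> kleene g n b \<and> m = prod_encode (a, b)" by blast
next
  assume "\<exists>a b. kleene f n a \<and> kleene g n b \<and> m = prod_encode (a, b)"
  then obtain a b where "kleene f n a" "kleene g n b" and m: "m = prod_encode (a, b)" by blast
  then show "kleene (prod_encode (5, prod_encode (f, g))) n m"
    unfolding m by (blast intro: kleene.pair kleene.pair_snd)
qed

lemma kleene_mu_aux:
  "kleene c v m \<Longrightarrow> c = prod_encode (10, prod_encode (f, prod_encode (n, k))) \<Longrightarrow>
    kleene f (prod_encode (n, k)) v \<Longrightarrow>
    k \<le> m \<and> kleene f (prod_encode (n, m)) 0 \<and>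
    (\<forall>i. k \<le> i \<and> i < m \<longrightarrow> (\<exists>w. kleene f (prod_encode (n, i)) (Suc w)))"
proof (induct c v m arbitrary: k rule: kleene.induct)
  case (mu_next f' n' k' r m v)
  then have eqs: "f' = f" "n' = n" "k' = k" by simp_all
  have IH: "Suc k \<le> m \<and> kleene f (prod_encode (n, m)) 0 \<and>
      (\<forall>i. Suc k \<le> i \<and> i < m \<longrightarrow> (\<exists>w. kleene f (prod_encode (n, i)) (Suc w)))"
    using mu_next(4)[of "Suc k"] mu_next(1) by (simp add: eqs)
  have "\<exists>w. kleene f (prod_encode (n, i)) (Suc w)" if "k \<le> i" "i < m" for i
  proof (cases "i = k")
    case True
    with mu_next.prems(2) show ?thesis by blast
  next
    case False
    with that have "Suc k \<le> i" by simp
    with IH that(2) show ?thesis by blast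
  qed
  with IH show ?case by (simp add: Suc_leD)
qed auto

lemma kleene_mu_aux':
  "kleene f (prod_encode (n, m)) 0 \<Longrightarrow> i \<le> m \<Longrightarrow>
    (\<forall>j. j < m \<longrightarrow> (\<exists>w. kleene f (prod_encode (n, j)) (Suc w))) \<Longrightarrow>
    \<exists>v. kleene f (prod_encode (n, m - i)) v \<and>
      kleene (prod_encode (10, prod_encode (f, prod_encode (n, m - i)))) v m"
proof (induct i)
  case 0
  then show ?case by (auto intro: kleene.mu_stop)
next
  case (Suc i)
  then obtain v where v: "kleene f (prod_encode (n, m - i)) v"
    "kleene (prod_encode (10, prod_encode (f, prod_encode (n, m - i)))) v m" by auto
  have eq: "m - i = Suc (m - Suc i)" using Suc.prems by simp
  obtain w where "kleene f (prod_encode (n, m - Suc i)) (Suc w)"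
    using Suc.prems by force
  then show ?case using v unfolding eq by (blast intro: kleene.mu_next)
qed

lemma kleene_mu_iff:
  "kleene (prod_encode (7, f)) n m \<longleftrightarrow>
    kleene f (prod_encode (n, m)) 0 \<and>
    (\<forall>k<m. \<exists>v. kleene f (prod_encode (n, k)) (Suc v))"
proof
  assume "kleene (prod_encode (7, f)) n m"
  then obtain r where "kleene f (prod_encode (n, 0)) r"
    "kleene (prod_encode (10, prod_encode (f, prod_encode (n, 0)))) r m"
    by (cases rule: kleene.cases) auto
  then show "kleene f (prod_encode (n, m)) 0 \<and>
    (\<forall>k<m. \<exists>v. kleene f (prod_encode (n, k)) (Suc v))"
    using kleene_mu_aux[OF _ refl] by blast
next
  assume "kleene f (prod_encode (n, m)) 0 \<and>
    (\<forall>k<m. \<exists>v. kleene f (prod_encode (n, k)) (Suc v))"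
  then show "kleene (prod_encode (7, f)) n m"
    using kleene_mu_aux'[of f n m m] by (auto intro: kleene.mu)
qed

section \<open>Formulas and intuitionistic derivability\<close>

text \<open>De Bruijn indices: \<open>Var 0\<close> is the innermost bound variable.\<close>

datatype tm = Var nat | Zero | Succ tm | Fn pfun "tm list"

datatype fm =
    Eq tm tm (infix "\<^bold>=" 60)
  | VSet tm
  | Mng tm
  | Tru tm
  | Bot
  | Conj fm fm (infixr "\<^bold>\<and>" 55)
  | Disj fm fm (infixr "\<^bold>\<or>" 52)
  | Impl fm fm (infixr "\<^bold>\<longrightarrow>" 50)
  | All fm
  | Ex fm

primrec sub_tm :: "(nat \<Rightarrow> tm) \<Rightarrow> tm \<Rightarrow> tm" where
  "sub_tm \<sigma> (Var i) = \<sigma> i"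
| "sub_tm \<sigma> Zero = Zero"
| "sub_tm \<sigma> (Succ t) = Succ (sub_tm \<sigma> t)"
| "sub_tm \<sigma> (Fn f ts) = Fn f (map (sub_tm \<sigma>) ts)"

definition lift_tm :: "tm \<Rightarrow> tm" where
  "lift_tm = sub_tm (\<lambda>i. Var (Suc i))"

definition up :: "(nat \<Rightarrow> tm) \<Rightarrow> nat \<Rightarrow> tm" where
  "up \<sigma> = case_nat (Var 0) (\<lambda>i. lift_tm (\<sigma> i))"

primrec sub :: "(nat \<Rightarrow> tm) \<Rightarrow> fm \<Rightarrow> fm" where
  "sub \<sigma> (s \<^bold>= t) = (sub_tm \<sigma> s \<^bold>= sub_tm \<sigma> t)"
| "sub \<sigma> (VSet t) = VSet (sub_tm \<sigma> t)"
| "sub \<sigma> (Mng t) = Mng (sub_tm \<sigma> t)"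
| "sub \<sigma> (Tru t) = Tru (sub_tm \<sigma> t)"
| "sub \<sigma> Bot = Bot"
| "sub \<sigma> (p \<^bold>\<and> q) = (sub \<sigma> p \<^bold>\<and> sub \<sigma> q)"
| "sub \<sigma> (p \<^bold>\<or> q) = (sub \<sigma> p \<^bold>\<or> sub \<sigma> q)"
| "sub \<sigma> (p \<^bold>\<longrightarrow> q) = (sub \<sigma> p \<^bold>\<longrightarrow> sub \<sigma> q)"
| "sub \<sigma> (All p) = All (sub (up \<sigma>) p)"
| "sub \<sigma> (Ex p) = Ex (sub (up \<sigma>) p)"

definition lift :: "fm \<Rightarrow> fm" where
  "lift = sub (\<lambda>i. Var (Suc i))"

text \<open>
  A formula \<open>p\<close> used as a predicate of \<open>k\<close> arguments has them as variables
  \<open>0, \<dots>, k - 1\<close> and its parameters as variables \<open>k, k + 1, \<dots>\<close>.  \<open>inst ts d p\<close> is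
  \<open>p(ts)\<close> as it is written underneath \<open>d\<close> quantifiers.
\<close>

definition inst :: "tm list \<Rightarrow> nat \<Rightarrow> fm \<Rightarrow> fm" where
  "inst ts d = sub (\<lambda>i. if i < length ts then ts ! i else Var (i - length ts + d))"

inductive deriv :: "fm set \<Rightarrow> fm set \<Rightarrow> fm \<Rightarrow> bool" for Ax :: "fm set" where
  ax: "p \<in> Ax \<Longrightarrow> deriv Ax \<Gamma> p"
| hyp: "p \<in> \<Gamma> \<Longrightarrow> deriv Ax \<Gamma> p"
| BotE: "deriv Ax \<Gamma> Bot \<Longrightarrow> deriv Ax \<Gamma> p"
| ConjI: "deriv Ax \<Gamma> p \<Longrightarrow> deriv Ax \<Gamma> q \<Longrightarrow> deriv Ax \<Gamma> (p \<^bold>\<and> q)"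
| ConjE1: "deriv Ax \<Gamma> (p \<^bold>\<and> q) \<Longrightarrow> deriv Ax \<Gamma> p"
| ConjE2: "deriv Ax \<Gamma> (p \<^bold>\<and> q) \<Longrightarrow> deriv Ax \<Gamma> q"
| DisjI1: "deriv Ax \<Gamma> p \<Longrightarrow> deriv Ax \<Gamma> (p \<^bold>\<or> q)"
| DisjI2: "deriv Ax \<Gamma> q \<Longrightarrow> deriv Ax \<Gamma> (p \<^bold>\<or> q)"
| DisjE: "deriv Ax \<Gamma> (p \<^bold>\<or> q) \<Longrightarrow> deriv Ax (insert p \<Gamma>) r \<Longrightarrow> deriv Ax (insert q \<Gamma>) r \<Longrightarrow>
    deriv Ax \<Gamma> r"
| ImplI: "deriv Ax (insert p \<Gamma>) q \<Longrightarrow> deriv Ax \<Gamma> (p \<^bold>\<longrightarrow> q)"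
| ImplE: "deriv Ax \<Gamma> (p \<^bold>\<longrightarrow> q) \<Longrightarrow> deriv Ax \<Gamma> p \<Longrightarrow> deriv Ax \<Gamma> q"
| AllI: "deriv Ax (lift ` \<Gamma>) p \<Longrightarrow> deriv Ax \<Gamma> (All p)"
| AllE: "deriv Ax \<Gamma> (All p) \<Longrightarrow> deriv Ax \<Gamma> (inst [t] 0 p)"
| ExI: "deriv Ax \<Gamma> (inst [t] 0 p) \<Longrightarrow> deriv Ax \<Gamma> (Ex p)"
| ExE: "deriv Ax \<Gamma> (Ex p) \<Longrightarrow> deriv Ax (insert p (lift ` \<Gamma>)) (lift r) \<Longrightarrow> deriv Ax \<Gamma> r"
| EqI: "deriv Ax \<Gamma> (t \<^bold>= t)"
| EqE: "deriv Ax \<Gamma> (s \<^bold>= t) \<Longrightarrow> deriv Ax \<Gamma> (inst [s] 0 p) \<Longrightarrow> deriv Ax \<Gamma> (inst [t] 0 p)"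

section \<open>The formal system\<close>

inductive_set HA :: "fm set" where
  Succ_Zero: "(Succ t \<^bold>= Zero \<^bold>\<longrightarrow> Bot) \<in> HA"
| Succ_inj: "(Succ s \<^bold>= Succ t \<^bold>\<longrightarrow> s \<^bold>= t) \<in> HA"
| induction: "(inst [Zero] 0 p \<^bold>\<longrightarrow> All (p \<^bold>\<longrightarrow> inst [Succ (Var 0)] 1 p) \<^bold>\<longrightarrow> All p) \<in> HA"
| PZero: "(Fn PZero ts \<^bold>= Zero) \<in> HA"
| PSucc: "(Fn PSucc ts \<^bold>= Succ (arg Zero 0 ts)) \<in> HA"
| PProj: "(Fn (PProj i) ts \<^bold>= arg Zero i ts) \<in> HA"
| PComp: "(Fn (PComp f gs) ts \<^bold>= Fn f (map (\<lambda>g. Fn g ts) gs)) \<in> HA"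
| PRec_Nil: "(Fn (PRec f g) [] \<^bold>= Fn f []) \<in> HA"
| PRec_Zero: "(Fn (PRec f g) (Zero # ts) \<^bold>= Fn f ts) \<in> HA"
| PRec_Succ: "(Fn (PRec f g) (Succ t # ts) \<^bold>= Fn g (t # Fn (PRec f g) (t # ts) # ts)) \<in> HA"

abbreviation proj_L :: "tm \<Rightarrow> tm" where
  "proj_L t \<equiv> Fn pr_L [t]"

abbreviation proj_R :: "tm \<Rightarrow> tm" where
  "proj_R t \<equiv> Fn pr_R [t]"

text \<open>\<open>App e n m\<close>: the application \<open>e n\<close> is defined and equal to \<open>m\<close>.\<close>

definition App :: "tm \<Rightarrow> tm \<Rightarrow> tm \<Rightarrow> fm" where
  "App e n m = Ex (Fn pr_run [Var 0, lift_tm e, lift_tm n] \<^bold>= Succ (lift_tm m))"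

definition defined :: "tm \<Rightarrow> tm \<Rightarrow> fm" where
  "defined e n = Ex (App (lift_tm e) (lift_tm n) (Var 0))"

text \<open>\<open>at_App e n p\<close>: the application \<open>e n\<close> is defined and \<open>p\<close> holds of its value, which is
  \<open>Var 0\<close> in \<open>p\<close>.\<close>

definition at_App :: "tm \<Rightarrow> tm \<Rightarrow> fm \<Rightarrow> fm" where
  "at_App e n p = Ex (App (lift_tm e) (lift_tm n) (Var 0) \<^bold>\<and> p)"

text \<open>
  The antecedent of (V1) for \<open>x\<close> with the unary predicate \<open>p\<close> in place of \<open>VSet\<close>, written
  underneath \<open>d\<close> quantifiers.
\<close>

definition v_closed :: "fm \<Rightarrow> nat \<Rightarrow> tm \<Rightarrow> fm" where
  "v_closed p d x =
     All (at_App (lift_tm x) (Var 0)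
       (Mng (proj_R (Var 0)) \<^bold>\<and>
        (Tru (proj_R (Var 0)) \<^bold>\<longrightarrow> inst [proj_L (Var 0)] (d + 2) p)))"

definition V1 :: fm where
  "V1 = All (v_closed (VSet (Var 0)) 1 (Var 0) \<^bold>\<longrightarrow> VSet (Var 0))"

definition V2 :: "fm \<Rightarrow> fm" where
  "V2 p = (All (v_closed p 1 (Var 0) \<^bold>\<longrightarrow> p) \<^bold>\<longrightarrow> All (VSet (Var 0) \<^bold>\<longrightarrow> p))"

text \<open>In (X1) and (X2), \<open>f\<close> is \<open>Var 1\<close> and \<open>g\<close> is \<open>Var 0\<close>, and \<open>\<Xi>\<close> is a binary symbol.\<close>

definition X1 :: "pfun \<Rightarrow> fm" where
  "X1 \<Xi> =
    (let c = Fn \<Xi> [Var 1, Var 0];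
         q = All (at_App (Var 2) (Var 0) (Tru (Var 0)) \<^bold>\<longrightarrow> at_App (Var 1) (Var 0) (Tru (Var 0)))
     in All (All (Mng c \<^bold>\<longrightarrow> (Tru c \<^bold>\<longrightarrow> q) \<^bold>\<and> (q \<^bold>\<longrightarrow> Tru c))))"

definition X2 :: "pfun \<Rightarrow> fm" where
  "X2 \<Xi> = All (All
    (All (defined (Var 2) (Var 0) \<^bold>\<longrightarrow> at_App (Var 2) (Var 0) (Mng (Var 0))) \<^bold>\<longrightarrow>
     All (at_App (Var 2) (Var 0) (Tru (Var 0)) \<^bold>\<and> defined (Var 1) (Var 0) \<^bold>\<longrightarrow>
       at_App (Var 1) (Var 0) (Mng (Var 0))) \<^bold>\<longrightarrow>
     Mng (Fn \<Xi> [Var 1, Var 0])))"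

text \<open>As all primitive recursive functions have symbols, a \<open>\<Sigma>\<^sub>1\<close> formula is an existential
  quantification of a quantifier-free arithmetical formula.\<close>

inductive quantifier_free :: "fm \<Rightarrow> bool" where
  "quantifier_free (s \<^bold>= t)"
| "quantifier_free Bot"
| "quantifier_free p \<Longrightarrow> quantifier_free q \<Longrightarrow> quantifier_free (p \<^bold>\<and> q)"
| "quantifier_free p \<Longrightarrow> quantifier_free q \<Longrightarrow> quantifier_free (p \<^bold>\<or> q)"
| "quantifier_free p \<Longrightarrow> quantifier_free q \<Longrightarrow> quantifier_free (p \<^bold>\<longrightarrow> q)"

inductive sigma1 :: "fm \<Rightarrow> bool" where
  "quantifier_free p \<Longrightarrow> sigma1 p"
| "sigma1 p \<Longrightarrow> sigma1 (Ex p)"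

inductive almost_negative :: "fm \<Rightarrow> bool" where
  "sigma1 p \<Longrightarrow> almost_negative p"
| "almost_negative (VSet t)"
| "almost_negative (Mng t)"
| "almost_negative (Tru t)"
| "almost_negative p \<Longrightarrow> almost_negative q \<Longrightarrow> almost_negative (p \<^bold>\<and> q)"
| "almost_negative p \<Longrightarrow> almost_negative q \<Longrightarrow> almost_negative (p \<^bold>\<longrightarrow> q)"
| "almost_negative p \<Longrightarrow> almost_negative (All p)"

text \<open>Here \<open>n\<close> is \<open>Var 0\<close> in \<open>p\<close>, whereas \<open>m\<close> is \<open>Var 0\<close> and \<open>n\<close> is \<open>Var 1\<close> in \<open>q\<close>.\<close>

definition ECT :: "fm \<Rightarrow> fm \<Rightarrow> fm" where
  "ECT p q = (All (p \<^bold>\<longrightarrow> Ex q) \<^bold>\<longrightarrow>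
     Ex (All (inst [Var 0] 2 p \<^bold>\<longrightarrow> at_App (Var 1) (Var 0) (inst [Var 0, Var 1] 3 q))))"

definition axioms :: "pfun \<Rightarrow> fm set" where
  "axioms \<Xi> = HA \<union> {V1} \<union> range V2 \<union> {X1 \<Xi>, X2 \<Xi>} \<union> {ECT p q | p q. almost_negative p}"

definition provable :: "pfun \<Rightarrow> fm \<Rightarrow> bool" where
  "provable \<Xi> p \<longleftrightarrow> deriv (axioms \<Xi>) {} p"

section \<open>The v-set interpretation\<close>

text \<open>\<open>in_EL a x\<close> states that \<open>a\<close> is \<open>el\<^sub>x(n)\<close> for some \<open>n\<close> with \<open>\<T>(cd\<^sub>x(n))\<close>.\<close>

definition in_EL :: "tm \<Rightarrow> tm \<Rightarrow> fm" where
  "in_EL a x = Ex (at_App (lift_tm x) (Var 0)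
     (Tru (proj_R (Var 0)) \<^bold>\<and> lift_tm (lift_tm a) \<^bold>= proj_L (Var 0)))"

definition All_set :: "fm \<Rightarrow> fm" where
  "All_set p = All (VSet (Var 0) \<^bold>\<longrightarrow> p)"

definition Ex_set :: "fm \<Rightarrow> fm" where
  "Ex_set p = Ex (VSet (Var 0) \<^bold>\<and> p)"

definition Ball_set :: "tm \<Rightarrow> fm \<Rightarrow> fm" where
  "Ball_set x p = All (in_EL (Var 0) (lift_tm x) \<^bold>\<longrightarrow> p)"

definition Bex_set :: "tm \<Rightarrow> fm \<Rightarrow> fm" where
  "Bex_set x p = Ex (in_EL (Var 0) (lift_tm x) \<^bold>\<and> p)"

end

theory Submission
  imports Defs
begin

text \<open>
  Write \<open>T\<^sub>x(n)\<close> for the truth of \<open>cd\<^sub>x(n)\<close>.  As \<open>x n\<close> is defined for all \<open>n\<close> when \<open>x\<close> is a v-set,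
  \<open>T\<^sub>x(n)\<close> is equivalent to an almost negative formula, and \<open>ECT\<close> gives an index \<open>e\<close> such that
  \<open>T\<^sub>x(n)\<close> implies that \<open>e n\<close> is defined and is a v-set related to \<open>el\<^sub>x(n)\<close>.  The required set
  consists of the values \<open>e n\<close> with \<open>T\<^sub>x(n)\<close>.  A v-set must be enumerated by a total function, while
  \<open>e n\<close> may be undefined; so its enumeration runs through the pairs \<open>\<langle>n, s\<rangle>\<close>, which yield
  \<open>\<langle>e n, cd\<^sub>x(n)\<rangle>\<close> if \<open>e n\<close> halts within \<open>s\<close> steps, and otherwise carry a condition that is meaningful
  and false.  The total function itself comes from \<open>ECT\<close> as well, so the only facts about the
  evaluator needed inside Heyting arithmetic are that values are unique and that some index
  is nowhere defined.
\<close>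

section \<open>Substitution\<close>

text \<open>To say that \<open>x n\<close> has a true right component, an existential quantifier
  over its value must stand in front of the atom \<open>Tru\<close>, and no almost negative formula
  allows this. Since application is single-valued, the universal form "every value of
  \<open>x n\<close> has a true right component" is equivalent to it and can serve as the domain in
  \<open>ECT\<close>. Choice is made along positions \<open>n\<close>, never along elements up to
  extensional equality, so \<psi> may be any formula. Positions where \<open>e n\<close> has not
  halted cannot be filled with a default element: by the second clause of strong collection, every
  element of \<open>y\<close> must be related to one of \<open>x\<close>. Hence a false condition,
  obtained as \<Xi>(h, g) with \<open>h\<close> constantly a true condition and \<open>g\<close>
  nowhere defined. That a v-set has a total enumeration is itself the inversion of (V1) and needs
  (V2). Because derivability is deeply embedded, Cantor pairing and the persistence of halted states
  have to be derived from the recursion equations of Heyting arithmetic.\<close>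

lemma sub_tm_sub_tm: "sub_tm \<tau> (sub_tm \<sigma> t) = sub_tm (\<lambda>i. sub_tm \<tau> (\<sigma> i)) t"
  by (induct t) simp_all

lemma sub_tm_Var [simp]: "sub_tm Var t = t"
  by (induct t) (simp_all add: map_idI)

lemma up_simps [simp]: "up \<sigma> 0 = Var 0" "up \<sigma> (Suc i) = lift_tm (\<sigma> i)"
  by (simp_all add: up_def)

lemma up_numeral [simp]: "up \<sigma> (numeral k) = lift_tm (\<sigma> (pred_numeral k))"
  by (simp add: numeral_eq_Suc)

lemma lift_tm_simps [simp]:
  "lift_tm (Var i) = Var (Suc i)" "lift_tm Zero = Zero" "lift_tm (Succ t) = Succ (lift_tm t)"
  "lift_tm (Fn f ts) = Fn f (map lift_tm ts)"
  by (simp_all add: lift_tm_def)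

lemma up_Var [simp]: "up Var = Var"
  by (rule ext) (simp add: up_def split: nat.split)

lemma sub_tm_up_lift [simp]: "sub_tm (up \<sigma>) (lift_tm t) = lift_tm (sub_tm \<sigma> t)"
  by (simp add: lift_tm_def sub_tm_sub_tm)

lemma up_sub_tm: "(\<lambda>i. sub_tm (up \<tau>) (up \<sigma> i)) = up (\<lambda>i. sub_tm \<tau> (\<sigma> i))"
proof
  show "sub_tm (up \<tau>) (up \<sigma> i) = up (\<lambda>i. sub_tm \<tau> (\<sigma> i)) i" for i
    by (cases i) simp_all
qed

lemma sub_sub: "sub \<tau> (sub \<sigma> p) = sub (\<lambda>i. sub_tm \<tau> (\<sigma> i)) p"
  by (induct p arbitrary: \<sigma> \<tau>) (simp_all add: sub_tm_sub_tm up_sub_tm)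

lemma sub_Var [simp]: "sub Var p = p"
  by (induct p) simp_all

text \<open>Instantiation as the head of a substitution: \<open>t \<cdot> Var\<close> replaces
  variable 0 by \<open>t\<close> and lowers the others. Unlike \<open>inst\<close> with its test on
  the length of a list, this form is computed by equations.\<close>

definition scons :: "tm \<Rightarrow> (nat \<Rightarrow> tm) \<Rightarrow> nat \<Rightarrow> tm" (infixr "\<cdot>" 65) where
  "t \<cdot> \<sigma> = case_nat t \<sigma>"

lemma scons_simps [simp]: "(t \<cdot> \<sigma>) 0 = t" "(t \<cdot> \<sigma>) (Suc i) = \<sigma> i"
  by (simp_all add: scons_def)

lemma scons_numeral [simp]: "(t \<cdot> \<sigma>) (numeral k) = \<sigma> (pred_numeral k)"
  by (simp add: numeral_eq_Suc)

lemma scons_add [simp]: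
  "(t \<cdot> \<sigma>) (i + numeral k) = \<sigma> (i + pred_numeral k)"
  by (simp add: numeral_eq_Suc)

lemma sub_tm_scons_lift [simp]: "sub_tm (t \<cdot> \<sigma>) (lift_tm s) = sub_tm \<sigma> s"
  by (simp add: lift_tm_def sub_tm_sub_tm)

text \<open>The beta law: passing under a binder and then filling the bound variable is one
  substitution, since both sides agree at 0 and at each successor. Instances of quantifiers that a
  substitution has crossed are normalized by it.\<close>

lemma sub_scons_up [simp]: "sub (t \<cdot> Var) (sub (up \<sigma>) p) = sub (t \<cdot> \<sigma>) p"
proof -
  have "(\<lambda>i. sub_tm (t \<cdot> Var) (up \<sigma> i)) = t \<cdot> \<sigma>"
  proof
    show "sub_tm (t \<cdot> Var) (up \<sigma> i) = (t \<cdot> \<sigma>) i" for i by (cases i) simp_all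
  qed
  then show ?thesis by (simp add: sub_sub)
qed

lemma up_scons: "up (t \<cdot> \<sigma>) = Var 0 \<cdot> lift_tm t \<cdot> (\<lambda>i. lift_tm (\<sigma> i))"
  by (auto simp: fun_eq_iff up_def scons_def split: nat.split)

lemma up_add [simp]: "up \<sigma> (i + numeral k) = lift_tm (\<sigma> (i + pred_numeral k))"
  by (simp add: numeral_eq_Suc)

lemma sub_tm_comp_scons [simp]:
  "(\<lambda>i. sub_tm \<tau> ((t \<cdot> \<sigma>) i)) = sub_tm \<tau> t \<cdot> (\<lambda>i. sub_tm \<tau> (\<sigma> i))"
  by (auto simp: scons_def fun_eq_iff split: nat.split)

lemma sub_sub_scons [simp]:
  "sub \<tau> (sub (t \<cdot> \<sigma>) p) = sub (sub_tm \<tau> t \<cdot> (\<lambda>i. sub_tm \<tau> (\<sigma> i))) p"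
  by (simp add: sub_sub)

lemma inst1: "inst [t] d p = sub (t \<cdot> (\<lambda>i. Var (i + d))) p"
  unfolding inst_def
  by (rule arg_cong[where f = "\<lambda>\<sigma>. sub \<sigma> p"]) (auto simp: scons_def split: nat.split)

lemma inst2: "inst [s, t] d p = sub (s \<cdot> t \<cdot> (\<lambda>i. Var (i + d))) p"
  unfolding inst_def
  by (rule arg_cong[where f = "\<lambda>\<sigma>. sub \<sigma> p"]) (auto simp: scons_def fun_eq_iff split: nat.split)

lemma sub_inst1 [simp]:
  "sub \<sigma> (inst [t] d p) = sub (sub_tm \<sigma> t \<cdot> (\<lambda>i. \<sigma> (i + d))) p"
  by (simp add: inst1)

lemma sub_inst2 [simp]:
  "sub \<sigma> (inst [s, t] d p) = sub (sub_tm \<sigma> s \<cdot> sub_tm \<sigma> t \<cdot> (\<lambda>i. \<sigma> (i + d))) p"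
  by (simp add: inst2)

lemma up_funpow: "(up ^^ k) \<sigma> i =
    (if i < k then Var i else sub_tm (\<lambda>j. Var (j + k)) (\<sigma> (i - k)))"
proof (induct k arbitrary: i)
  case (Suc k)
  show ?case
    by (cases i) (simp_all add: Suc lift_tm_def sub_tm_sub_tm)
qed simp

text \<open>A predicate formula absorbs a substitution of its parameters: \<open>up\<close> protects
  its argument variables, while the arguments themselves are substituted underneath \<open>d\<close>
  quantifiers. Instances of the axiom schemes thereby remain instances.\<close>

lemma sub_inst_up: "sub ((up ^^ d) \<sigma>) (inst ts d p) =
    inst (map (sub_tm ((up ^^ d) \<sigma>)) ts) d (sub ((up ^^ length ts) \<sigma>) p)"
  unfolding inst_def sub_sub
  by (rule arg_cong[where f = "\<lambda>\<sigma>. sub \<sigma> p"]) (auto simp: up_funpow sub_tm_sub_tm fun_eq_iff)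

lemma sub_App [simp]: "sub \<sigma> (App e n m) = App (sub_tm \<sigma> e) (sub_tm \<sigma> n) (sub_tm \<sigma> m)"
  by (simp add: App_def)

lemma sub_defined [simp]: "sub \<sigma> (defined e n) = defined (sub_tm \<sigma> e) (sub_tm \<sigma> n)"
  by (simp add: defined_def)

lemma sub_at_App [simp]:
  "sub \<sigma> (at_App e n p) = at_App (sub_tm \<sigma> e) (sub_tm \<sigma> n) (sub (up \<sigma>) p)"
  by (simp add: at_App_def)

lemma sub_in_EL [simp]: "sub \<sigma> (in_EL a x) = in_EL (sub_tm \<sigma> a) (sub_tm \<sigma> x)"
  by (simp add: in_EL_def)

lemma sub_v_closed: "sub ((up ^^ d) \<sigma>) (v_closed p d x) =
    v_closed (sub (up \<sigma>) p) d (sub_tm ((up ^^ d) \<sigma>) x)"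
  using sub_inst_up[of "d + 2" \<sigma> "[proj_L (Var 0)]" p]
  by (simp add: v_closed_def del: sub_inst1)

section \<open>Closure of the axioms under substitution\<close>

lemma quantifier_free_sub: "quantifier_free p \<Longrightarrow> quantifier_free (sub \<sigma> p)"
  by (induct rule: quantifier_free.induct) (simp_all add: quantifier_free.intros)

lemma sigma1_sub: "sigma1 p \<Longrightarrow> sigma1 (sub \<sigma> p)"
  by (induct arbitrary: \<sigma> rule: sigma1.induct)
    (auto simp: quantifier_free_sub intro: sigma1.intros)

lemma almost_negative_sub: "almost_negative p \<Longrightarrow> almost_negative (sub \<sigma> p)"
  by (induct arbitrary: \<sigma> rule: almost_negative.induct)
    (auto simp: sigma1_sub intro: almost_negative.intros)

lemma sub_tm_arg: "sub_tm \<sigma> (arg Zero i ts) = arg Zero i (map (sub_tm \<sigma>) ts)"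
  by (simp add: arg_def)

lemma HA_sub: "p \<in> HA \<Longrightarrow> sub \<sigma> p \<in> HA"
proof (induct rule: HA.induct)
  case (induction p)
  show ?case
    using HA.induction[of "sub (up \<sigma>) p"]
      sub_inst_up[of 0 \<sigma> "[Zero]" p] sub_inst_up[of 1 \<sigma> "[Succ (Var 0)]" p]
    by (simp del: sub_inst1)
next
  case (PComp f gs ts)
  show ?case using HA.PComp[of f gs "map (sub_tm \<sigma>) ts"] by (simp add: o_def)
qed (simp_all add: sub_tm_arg HA.intros)

lemma V2_sub: "sub \<sigma> (V2 p) = V2 (sub (up \<sigma>) p)"
  using sub_v_closed[of 1 \<sigma> p "Var 0"] by (simp add: V2_def)

lemma ECT_sub: "sub \<sigma> (ECT p q) = ECT (sub (up \<sigma>) p) (sub (up (up \<sigma>)) q)"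
  using sub_inst_up[of 2 \<sigma> "[Var 0]" p] sub_inst_up[of 3 \<sigma> "[Var 0, Var 1]" q]
  by (simp add: ECT_def numeral_eq_Suc del: sub_inst1 sub_inst2)

text \<open>\<open>V1\<close>, \<open>X1\<close> and \<open>X2\<close> are closed, and the schemes
  pass the substitution on to their formula parameters; almost negativity survives because only
  terms change. Renaming variables in derivations rests on this.\<close>

lemma axioms_sub: "p \<in> axioms \<Xi> \<Longrightarrow> sub \<sigma> p \<in> axioms \<Xi>"
proof -
  have "sub \<sigma> V1 = V1"
    using sub_v_closed[of 1 \<sigma> "VSet (Var 0)" "Var 0"] by (simp add: V1_def)
  moreover have "sub \<sigma> (X1 \<Xi>) = X1 \<Xi>" "sub \<sigma> (X2 \<Xi>) = X2 \<Xi>"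
    by (simp_all add: X1_def X2_def Let_def numeral_2_eq_2)
  moreover assume "p \<in> axioms \<Xi>"
  ultimately show ?thesis
    unfolding axioms_def by (auto simp: HA_sub V2_sub) (metis ECT_sub almost_negative_sub)
qed

section \<open>Derivations\<close>

lemma deriv_weaken: "deriv Ax \<Gamma> p \<Longrightarrow> \<Gamma> \<subseteq> \<Delta> \<Longrightarrow> deriv Ax \<Delta> p"
proof (induct arbitrary: \<Delta> rule: deriv.induct)
  case (DisjE \<Gamma> p q r)
  then show ?case by (meson deriv.DisjE insert_mono)
next
  case (ImplI p \<Gamma> q)
  then show ?case by (meson deriv.ImplI insert_mono)
next
  case (AllI \<Gamma> p)
  then show ?case by (meson deriv.AllI image_mono)
next
  case (ExE \<Gamma> p r)
  then show ?case by (meson deriv.ExE image_mono insert_mono)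
next
  case (ImplE \<Gamma> p q)
  then show ?case by (meson deriv.ImplE)
next
  case (EqE \<Gamma> s t p)
  show ?case by (rule deriv.EqE[OF EqE(2,4)]) (fact EqE)+
next
  case (AllE \<Gamma> p t)
  then show ?case by (meson deriv.AllE)
next
  case (ExI \<Gamma> t p)
  then show ?case by (meson deriv.ExI)
next
  case (ConjE1 \<Gamma> p q)
  then show ?case by (meson deriv.ConjE1)
next
  case (ConjE2 \<Gamma> p q)
  then show ?case by (meson deriv.ConjE2)
next
  case (BotE \<Gamma> p)
  then show ?case by (meson deriv.BotE)
qed (auto intro: deriv.ax deriv.hyp deriv.ConjI deriv.DisjI1 deriv.DisjI2 deriv.EqI)

lemma sub_up_lift: "sub (up \<sigma>) (lift p) = lift (sub \<sigma> p)"
  by (simp add: lift_def sub_sub lift_tm_def)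

lemma sub_inst_term: "sub \<sigma> (inst [t] 0 p) = inst [sub_tm \<sigma> t] 0 (sub (up \<sigma>) p)"
  using sub_inst_up[of 0 \<sigma> "[t]" p] by (simp del: sub_inst1)

lemma deriv_sub:
  assumes Ax: "\<And>p \<sigma>. p \<in> Ax \<Longrightarrow> sub \<sigma> p \<in> Ax"
  shows "deriv Ax \<Gamma> p \<Longrightarrow> deriv Ax (sub \<sigma> ` \<Gamma>) (sub \<sigma> p)"
proof (induct arbitrary: \<sigma> rule: deriv.induct)
  case (AllI \<Gamma> p)
  then show ?case
    using AllI(2)[of "up \<sigma>"] by (auto simp: image_image sub_up_lift intro: deriv.AllI)
next
  case (AllE \<Gamma> p t)
  then show ?case by (auto simp: sub_inst_term simp del: sub_inst1 intro: deriv.AllE)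
next
  case (ExI \<Gamma> t p)
  then show ?case by (auto simp: sub_inst_term simp del: sub_inst1 intro: deriv.ExI)
next
  case (ExE \<Gamma> p r)
  show ?case
    using ExE(2)[of \<sigma>] ExE(4)[of "up \<sigma>"]
    by (auto simp: image_image sub_up_lift intro: deriv.ExE)
next
  case (EqE \<Gamma> s t p)
  show ?case
    using deriv.EqE[OF EqE(2)[of \<sigma>, unfolded sub.simps] EqE(4)[of \<sigma>, unfolded sub_inst_term]]
    by (simp only: sub_inst_term)
next
  case (DisjE \<Gamma> p q r)
  show ?case
    using deriv.DisjE[OF DisjE(2)[of \<sigma>, unfolded sub.simps]] DisjE(4,6)[of \<sigma>] by simp
next
  case (ImplI p \<Gamma> q)
  then show ?case by (simp add: deriv.ImplI)
next
  case (ImplE \<Gamma> p q)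
  then show ?case by (metis deriv.ImplE sub.simps(8))
next
  case (BotE \<Gamma> p)
  then show ?case by (metis deriv.BotE sub.simps(5))
next
  case (ConjE1 \<Gamma> p q)
  then show ?case by (metis deriv.ConjE1 sub.simps(6))
next
  case (ConjE2 \<Gamma> p q)
  then show ?case by (metis deriv.ConjE2 sub.simps(6))
qed (simp_all add: Ax deriv.ax deriv.hyp deriv.ConjI deriv.DisjI1 deriv.DisjI2 deriv.EqI)

section \<open>Fresh variables for finite contexts\<close>

lemma sub_tm_cong_bound: "\<exists>N. \<forall>\<sigma> \<tau>. (\<forall>i<N. \<sigma> i = \<tau> i) \<longrightarrow> sub_tm \<sigma> t = sub_tm \<tau> t"
proof (induct t)
  case (Var i)
  show ?case by (rule exI[of _ "Suc i"]) simp
next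
  case (Fn f ts)
  then obtain N where N: "\<And>t. t \<in> set ts \<Longrightarrow>
      \<forall>\<sigma> \<tau>. (\<forall>i<N t. \<sigma> i = \<tau> i) \<longrightarrow> sub_tm \<sigma> t = sub_tm \<tau> t" by metis
  have "N t \<le> Max (insert 0 (N ` set ts))" if "t \<in> set ts" for t
    using that by (intro Max_ge) auto
  then have "sub_tm \<sigma> t = sub_tm \<tau> t"
    if "\<forall>i<Max (insert 0 (N ` set ts)). \<sigma> i = \<tau> i" "t \<in> set ts" for \<sigma> \<tau> t
    using N[OF that(2)] that by (meson less_le_trans)
  then show ?case by (intro exI[of _ "Max (insert 0 (N ` set ts))"]) simp
next
  case (Succ t)
  then show ?case by (metis sub_tm.simps(3))
qed simp

text \<open>Stands in for a notion of free variable. Agreement below \<open>N\<close> is preserved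
  by \<open>up\<close>, so under a binder the same bound serves.\<close>

lemma sub_cong_bound: "\<exists>N. \<forall>\<sigma> \<tau>. (\<forall>i<N. \<sigma> i = \<tau> i) \<longrightarrow> sub \<sigma> p = sub \<tau> p"
proof -
  have two: "\<exists>N. (\<forall>\<sigma> \<tau>. (\<forall>i<N. \<sigma> i = \<tau> i) \<longrightarrow> f \<sigma> = f \<tau>) \<and>
      (\<forall>\<sigma> \<tau>. (\<forall>i<N. \<sigma> i = \<tau> i) \<longrightarrow> g \<sigma> = g \<tau>)"
    if "\<exists>N. \<forall>\<sigma> \<tau>. (\<forall>i<N. \<sigma> i = \<tau> i) \<longrightarrow> f \<sigma> = f \<tau>"
      "\<exists>N. \<forall>\<sigma> \<tau>. (\<forall>i<N. \<sigma> i = \<tau> i) \<longrightarrow> g \<sigma> = g \<tau>"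
    for f :: "(nat \<Rightarrow> tm) \<Rightarrow> 'a" and g :: "(nat \<Rightarrow> tm) \<Rightarrow> 'a"
  proof -
    from that obtain M N where "\<forall>\<sigma> \<tau>. (\<forall>i<M. \<sigma> i = \<tau> i) \<longrightarrow> f \<sigma> = f \<tau>"
      "\<forall>\<sigma> \<tau>. (\<forall>i<N. \<sigma> i = \<tau> i) \<longrightarrow> g \<sigma> = g \<tau>" by blast
    then show ?thesis by (intro exI[of _ "max M N"]) (meson max.strict_coboundedI1 max.strict_coboundedI2)
  qed
  have up_eq: "\<forall>i<N. up \<sigma> i = up \<tau> i" if "\<forall>i<N. \<sigma> i = \<tau> i" for N \<sigma> \<tau>
    using that by (auto simp: up_def split: nat.split)
  show ?thesis
  proof (induct p)
    case (Eq s t)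
    show ?case using two[OF sub_tm_cong_bound[of s] sub_tm_cong_bound[of t]]
      by (metis sub.simps(1))
  next
    case (VSet t)
    show ?case using sub_tm_cong_bound[of t] by (metis sub.simps(2))
  next
    case (Mng t)
    show ?case using sub_tm_cong_bound[of t] by (metis sub.simps(3))
  next
    case (Tru t)
    show ?case using sub_tm_cong_bound[of t] by (metis sub.simps(4))
  next
    case (Conj p q)
    show ?case using two[OF Conj] by (metis sub.simps(6))
  next
    case (Disj p q)
    show ?case using two[OF Disj] by (metis sub.simps(7))
  next
    case (Impl p q)
    show ?case using two[OF Impl] by (metis sub.simps(8))
  next
    case (All p)
    then show ?case using up_eq by (metis sub.simps(9))
  next
    case (Ex p)
    then show ?case using up_eq by (metis sub.simps(10))
  qed simp
qed

text \<open>A variable \<open>N\<close> beyond all variables of a finite context can play the part of the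
  eigenvariable: the substitution below renames it to the de Bruijn variable 0.\<close>

lemma fresh_renaming:
  assumes "finite \<Gamma>"
  obtains N \<sigma> where "\<And>p. p \<in> \<Gamma> \<Longrightarrow> sub \<sigma> p = lift p"
    and "sub \<sigma> (sub (Var N \<cdot> Var) q) = q"
proof -
  obtain B where B: "\<And>p. \<forall>\<sigma> \<tau>. (\<forall>i<B p. \<sigma> i = \<tau> i) \<longrightarrow> sub \<sigma> p = sub \<tau> p"
    using sub_cong_bound by metis
  define N where "N = Max (insert (B q) (B ` \<Gamma>))"
  have ge: "B p \<le> N" if "p \<in> insert q \<Gamma>" for p
    unfolding N_def using assms that by (intro Max_ge) auto
  define \<sigma> where "\<sigma> i = (if i = N then Var 0 else Var (Suc i))" for i
  have "sub \<sigma> p = lift p" if "p \<in> \<Gamma>" for p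
    unfolding lift_def using ge[of p] that by (intro B[rule_format]) (simp add: \<sigma>_def)
  moreover have "sub \<sigma> (sub (Var N \<cdot> Var) q) = sub Var q"
    unfolding sub_sub using ge[of q]
    by (intro B[rule_format]) (auto simp: \<sigma>_def scons_def split: nat.split)
  ultimately show thesis using that[of \<sigma> N] by simp
qed

text \<open>The premise for all terms is used only at a variable \<open>N\<close> fresh for the
  formulas involved. Renaming \<open>N\<close> to 0 and shifting the rest turns that one derivation
  into the eigenvariable premise of \<open>AllI\<close> or \<open>ExE\<close>.\<close>

lemma deriv_fresh:
  assumes Ax: "\<And>p \<sigma>. p \<in> Ax \<Longrightarrow> sub \<sigma> p \<in> Ax" and fin: "finite \<Gamma>"
  shows "(\<And>t. deriv Ax \<Gamma> (inst [t] 0 p)) \<Longrightarrow> deriv Ax \<Gamma> (All p)"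
    and "deriv Ax \<Gamma> (Ex p) \<Longrightarrow> (\<And>t. deriv Ax (insert (inst [t] 0 p) \<Gamma>) r) \<Longrightarrow> deriv Ax \<Gamma> r"
proof -
  obtain N \<sigma> where \<sigma>: "\<And>p. p \<in> insert r \<Gamma> \<Longrightarrow> sub \<sigma> p = lift p"
    "sub \<sigma> (sub (Var N \<cdot> Var) p) = p"
    using fresh_renaming[of "insert r \<Gamma>" p] fin by blast
  have img: "sub \<sigma> ` \<Gamma> = lift ` \<Gamma>" using \<sigma>(1) by auto
  show "deriv Ax \<Gamma> (All p)" if "\<And>t. deriv Ax \<Gamma> (inst [t] 0 p)"
    using deriv_sub[OF Ax that[of "Var N"], of \<sigma>] \<sigma>(2) img
    by (auto simp: inst1 intro: deriv.AllI)
  show "deriv Ax \<Gamma> r" if "deriv Ax \<Gamma> (Ex p)" "\<And>t. deriv Ax (insert (inst [t] 0 p) \<Gamma>) r"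
    using deriv_sub[OF Ax that(2)[of "Var N"], of \<sigma>] \<sigma> img
    by (auto simp: inst1 intro: deriv.ExE[OF that(1)])
qed

text \<open>Keeps the eleven branches abstract. A halted state and a state whose top index has tag
  11 enter none of them, so only their number matters in the formal system.\<close>

lemma pr_step_shape: "\<exists>as. length as = 11 \<and> pr_step =
    pr_if (pr_r (PProj 0)) (PProj 0)
      (pr_switch (pr_l (pr_l (PComp pr_pred [pr_r (PProj 0)]))) as (PProj 0))"
  unfolding pr_step_def Let_def by (rule exI, rule conjI[rotated], rule refl) simp

section \<open>Reasoning in the formal system\<close>

locale vset_system =
  fixes \<Xi> :: pfun
begin

definition prv :: "fm list \<Rightarrow> fm \<Rightarrow> bool" (infix "\<turnstile>" 40) where
  "\<Gamma> \<turnstile> p \<longleftrightarrow> deriv (axioms \<Xi>) (set \<Gamma>) p"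

text \<open>Contexts act like the worlds of a Kripke model ordered by inclusion: a goal is pursued
  in an arbitrary larger context in which the new assumption is derivable, so assumptions of the
  object logic become facts of the metalanguage.\<close>

definition ext :: "fm list \<Rightarrow> fm list \<Rightarrow> bool" (infix "\<lesssim>" 50) where
  "\<Gamma> \<lesssim> \<Delta> \<longleftrightarrow> set \<Gamma> \<subseteq> set \<Delta>"

lemma ext_refl [simp]: "\<Gamma> \<lesssim> \<Gamma>"
  by (simp add: ext_def)

lemma ext_trans [trans]: "\<Gamma> \<lesssim> \<Delta> \<Longrightarrow> \<Delta> \<lesssim> \<Theta> \<Longrightarrow> \<Gamma> \<lesssim> \<Theta>"
  by (simp add: ext_def)

lemma weaken: "\<Gamma> \<turnstile> p \<Longrightarrow> \<Gamma> \<lesssim> \<Delta> \<Longrightarrow> \<Delta> \<turnstile> p"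
  unfolding prv_def ext_def by (rule deriv_weaken)

lemma axiom: "p \<in> axioms \<Xi> \<Longrightarrow> \<Gamma> \<turnstile> p"
  unfolding prv_def by (rule deriv.ax)

lemma HA_axiom: "p \<in> HA \<Longrightarrow> \<Gamma> \<turnstile> p"
  by (rule axiom) (simp add: axioms_def)

lemma Bot_elim: "\<Gamma> \<turnstile> Bot \<Longrightarrow> \<Gamma> \<turnstile> p"
  unfolding prv_def by (rule deriv.BotE)

lemma Conj_iff [simp]: "\<Gamma> \<turnstile> p \<^bold>\<and> q \<longleftrightarrow> \<Gamma> \<turnstile> p \<and> \<Gamma> \<turnstile> q"
  unfolding prv_def by (meson deriv.ConjI deriv.ConjE1 deriv.ConjE2)

lemma Disj_intro1: "\<Gamma> \<turnstile> p \<Longrightarrow> \<Gamma> \<turnstile> p \<^bold>\<or> q"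
  unfolding prv_def by (rule deriv.DisjI1)

lemma Disj_intro2: "\<Gamma> \<turnstile> q \<Longrightarrow> \<Gamma> \<turnstile> p \<^bold>\<or> q"
  unfolding prv_def by (rule deriv.DisjI2)

lemma assumed: "p # \<Gamma> \<turnstile> p" "\<Gamma> \<lesssim> p # \<Gamma>"
  by (auto simp: prv_def ext_def intro: deriv.hyp)

lemma Disj_elim:
  assumes "\<Gamma> \<turnstile> p \<^bold>\<or> q"
    and "\<And>\<Delta>. \<Gamma> \<lesssim> \<Delta> \<Longrightarrow> \<Delta> \<turnstile> p \<Longrightarrow> \<Delta> \<turnstile> r"
    and "\<And>\<Delta>. \<Gamma> \<lesssim> \<Delta> \<Longrightarrow> \<Delta> \<turnstile> q \<Longrightarrow> \<Delta> \<turnstile> r"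
  shows "\<Gamma> \<turnstile> r"
  using assms(2)[OF assumed(2,1)] assms(3)[OF assumed(2,1)] deriv.DisjE[OF assms(1)[unfolded prv_def]]
  by (simp add: prv_def)

lemma Impl_intro: "(\<And>\<Delta>. \<Gamma> \<lesssim> \<Delta> \<Longrightarrow> \<Delta> \<turnstile> p \<Longrightarrow> \<Delta> \<turnstile> q) \<Longrightarrow> \<Gamma> \<turnstile> p \<^bold>\<longrightarrow> q"
  using deriv.ImplI[of "axioms \<Xi>" p "set \<Gamma>" q] assumed(1)[of p \<Gamma>] assumed(2)[of \<Gamma> p]
  by (metis list.simps(15) prv_def)

lemma Impl_elim: "\<Gamma> \<turnstile> p \<^bold>\<longrightarrow> q \<Longrightarrow> \<Gamma> \<turnstile> p \<Longrightarrow> \<Gamma> \<turnstile> q"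
  unfolding prv_def by (rule deriv.ImplE)

text \<open>Contexts are finite, so a fresh variable is always available; the quantifier rules may
  therefore speak about all terms instead of an eigenvariable.\<close>

lemma All_intro: "(\<And>t. \<Gamma> \<turnstile> sub (t \<cdot> Var) p) \<Longrightarrow> \<Gamma> \<turnstile> All p"
  unfolding prv_def using deriv_fresh(1)[of "axioms \<Xi>" "set \<Gamma>" p] axioms_sub
  by (simp add: inst1)

lemma All_elim: "\<Gamma> \<turnstile> All p \<Longrightarrow> \<Gamma> \<turnstile> sub (t \<cdot> Var) p"
  unfolding prv_def using deriv.AllE[of "axioms \<Xi>" "set \<Gamma>" p t] by (simp add: inst1)

lemma All_iff: "\<Gamma> \<turnstile> All p \<longleftrightarrow> (\<forall>t. \<Gamma> \<turnstile> sub (t \<cdot> Var) p)"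
  by (blast intro: All_intro All_elim)

lemma Ex_intro: "\<Gamma> \<turnstile> sub (t \<cdot> Var) p \<Longrightarrow> \<Gamma> \<turnstile> Ex p"
  unfolding prv_def using deriv.ExI[of "axioms \<Xi>" "set \<Gamma>" t p] by (simp add: inst1)

lemma Ex_elim:
  assumes "\<Gamma> \<turnstile> Ex p" and "\<And>t \<Delta>. \<Gamma> \<lesssim> \<Delta> \<Longrightarrow> \<Delta> \<turnstile> sub (t \<cdot> Var) p \<Longrightarrow> \<Delta> \<turnstile> r"
  shows "\<Gamma> \<turnstile> r"
proof -
  have "sub (t \<cdot> Var) p # \<Gamma> \<turnstile> r" for t
    by (rule assms(2)[of _ t]) (rule assumed)+
  then show ?thesis
    using assms(1) deriv_fresh(2)[of "axioms \<Xi>" "set \<Gamma>" p r] axioms_sub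
    by (simp add: prv_def inst1)
qed

lemma Eq_subst: "\<Gamma> \<turnstile> s \<^bold>= t \<Longrightarrow> \<Gamma> \<turnstile> sub (s \<cdot> Var) p \<Longrightarrow> \<Gamma> \<turnstile> sub (t \<cdot> Var) p"
  unfolding prv_def using deriv.EqE[of "axioms \<Xi>" "set \<Gamma>" s t p] by (simp add: inst1)

lemma Eq_refl: "\<Gamma> \<turnstile> t \<^bold>= t"
  unfolding prv_def by (rule deriv.EqI)

lemma Eq_sym: "\<Gamma> \<turnstile> s \<^bold>= t \<Longrightarrow> \<Gamma> \<turnstile> t \<^bold>= s"
  using Eq_subst[of \<Gamma> s t "Var 0 \<^bold>= lift_tm s"] by (simp add: Eq_refl)

lemma Eq_trans: "\<Gamma> \<turnstile> s \<^bold>= t \<Longrightarrow> \<Gamma> \<turnstile> t \<^bold>= u \<Longrightarrow> \<Gamma> \<turnstile> s \<^bold>= u"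
  using Eq_subst[of \<Gamma> t u "lift_tm s \<^bold>= Var 0"] by simp

lemma Succ_cong: "\<Gamma> \<turnstile> s \<^bold>= t \<Longrightarrow> \<Gamma> \<turnstile> Succ s \<^bold>= Succ t"
  using Eq_subst[of \<Gamma> s t "Succ (lift_tm s) \<^bold>= Succ (Var 0)"] by (simp add: Eq_refl)

lemma Fn_cong: "list_all2 (\<lambda>s t. \<Gamma> \<turnstile> s \<^bold>= t) ss ts \<Longrightarrow> \<Gamma> \<turnstile> Fn f ss \<^bold>= Fn f ts"
proof -
  \<comment> \<open>The prefix \<open>us\<close> collects the arguments already exchanged, since the
    equality rule replaces one term at a time.\<close>
  have "\<Gamma> \<turnstile> Fn f (us @ ss) \<^bold>= Fn f (us @ ts)"
    if "list_all2 (\<lambda>s t. \<Gamma> \<turnstile> s \<^bold>= t) ss ts" for us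
    using that
  proof (induct arbitrary: us rule: list_all2_induct)
    case (Cons s ss t ts)
    have "\<Gamma> \<turnstile> Fn f (us @ s # ss) \<^bold>= Fn f (us @ t # ss)"
      using Eq_subst[OF Cons(1), of "Fn f (map lift_tm (us @ s # ss)) \<^bold>=
          Fn f (map lift_tm us @ Var 0 # map lift_tm ss)"]
      by (simp add: o_def Eq_refl)
    moreover have "\<Gamma> \<turnstile> Fn f (us @ t # ss) \<^bold>= Fn f (us @ t # ts)"
      using Cons(3)[of "us @ [t]"] by simp
    ultimately show ?case by (rule Eq_trans)
  qed (simp add: Eq_refl)
  from this[of "[]"] show "list_all2 (\<lambda>s t. \<Gamma> \<turnstile> s \<^bold>= t) ss ts \<Longrightarrow> ?thesis" by simp
qed

lemma induction:
  assumes "\<Gamma> \<turnstile> sub (Zero \<cdot> Var) p"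
    and "\<And>t \<Delta>. \<Gamma> \<lesssim> \<Delta> \<Longrightarrow> \<Delta> \<turnstile> sub (t \<cdot> Var) p \<Longrightarrow> \<Delta> \<turnstile> sub (Succ t \<cdot> Var) p"
  shows "\<Gamma> \<turnstile> sub (t \<cdot> Var) p"
proof (rule All_elim)
  have "\<Gamma> \<turnstile> inst [Zero] 0 p \<^bold>\<longrightarrow> All (p \<^bold>\<longrightarrow> inst [Succ (Var 0)] 1 p) \<^bold>\<longrightarrow> All p"
    by (rule HA_axiom) (rule HA.induction)
  then show "\<Gamma> \<turnstile> All p"
  proof (rule Impl_elim[OF Impl_elim])
    show "\<Gamma> \<turnstile> inst [Zero] 0 p" using assms(1) by (simp add: inst1)
    show "\<Gamma> \<turnstile> All (p \<^bold>\<longrightarrow> inst [Succ (Var 0)] 1 p)"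
      by (rule All_intro) (auto intro!: Impl_intro assms(2))
  qed
qed

section \<open>Provable equality as an equation\<close>

text \<open>Choosing a representative of each class of provably equal terms turns provable equality
  in a context into an equation of the metalanguage, so that the simplifier can rewrite
  with it.\<close>

definition rep :: "fm list \<Rightarrow> tm \<Rightarrow> tm" where
  "rep \<Gamma> t = (SOME s. \<Gamma> \<turnstile> s \<^bold>= t)"

text \<open>The constructors acting on representatives. With \<open>rep\<close> pushed inward
  through terms, the equations of Heyting arithmetic become rewrite rules for \<open>fn\<close> and
  \<open>succ\<close>.\<close>

definition succ :: "fm list \<Rightarrow> tm \<Rightarrow> tm" where
  "succ \<Gamma> t = rep \<Gamma> (Succ t)"

definition fn :: "fm list \<Rightarrow> pfun \<Rightarrow> tm list \<Rightarrow> tm" where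
  "fn \<Gamma> f ts = rep \<Gamma> (Fn f ts)"

lemma rep_eq: "\<Gamma> \<turnstile> rep \<Gamma> t \<^bold>= t"
  unfolding rep_def by (rule someI) (rule Eq_refl)

text \<open>Provably equal terms have the same candidates for a representative, so
  \<open>SOME\<close> chooses alike for both; conversely each term is provably equal to its
  representative.\<close>

lemma Eq_iff: "\<Gamma> \<turnstile> s \<^bold>= t \<longleftrightarrow> rep \<Gamma> s = rep \<Gamma> t"
proof
  assume "\<Gamma> \<turnstile> s \<^bold>= t"
  then have "(\<Gamma> \<turnstile> u \<^bold>= s) = (\<Gamma> \<turnstile> u \<^bold>= t)" for u
    using Eq_trans[of \<Gamma> u s t] Eq_trans[of \<Gamma> u t s] Eq_sym by metis
  then show "rep \<Gamma> s = rep \<Gamma> t" by (simp add: rep_def)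
next
  assume "rep \<Gamma> s = rep \<Gamma> t"
  then show "\<Gamma> \<turnstile> s \<^bold>= t"
    using Eq_trans[OF Eq_sym[OF rep_eq[of \<Gamma> s]], of t] rep_eq[of \<Gamma> t] by simp
qed

lemma rep_rep [simp]: "rep \<Gamma> (rep \<Gamma> t) = rep \<Gamma> t"
  using rep_eq[of \<Gamma> t] by (simp add: Eq_iff)

lemma rep_Succ [simp]: "rep \<Gamma> (Succ t) = succ \<Gamma> (rep \<Gamma> t)"
  unfolding succ_def Eq_iff[symmetric] by (rule Succ_cong) (simp add: Eq_iff)

lemma rep_Fn [simp]: "rep \<Gamma> (Fn f ts) = fn \<Gamma> f (map (rep \<Gamma>) ts)"
  unfolding fn_def Eq_iff[symmetric]
  by (rule Fn_cong) (simp add: list_all2_conv_all_nth Eq_iff)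

lemma succ_rep: "succ \<Gamma> (rep \<Gamma> t) = succ \<Gamma> t"
  using rep_Succ[of \<Gamma> t] by (simp only: succ_def)

lemma fn_rep: "fn \<Gamma> f (map (rep \<Gamma>) ts) = fn \<Gamma> f ts"
  using rep_Fn[of \<Gamma> f ts] by (simp only: fn_def)

lemma rep_succ [simp]: "rep \<Gamma> (succ \<Gamma> t) = succ \<Gamma> t"
  by (simp only: succ_def rep_rep)

lemma rep_fn [simp]: "rep \<Gamma> (fn \<Gamma> f ts) = fn \<Gamma> f ts"
  by (simp only: fn_def rep_rep)

lemma fn_cong: "map (rep \<Gamma>) ss = map (rep \<Gamma>) ts \<Longrightarrow> fn \<Gamma> f ss = fn \<Gamma> f ts"
  by (metis fn_rep)

lemma fn_args: "fn \<Gamma> f [rep \<Gamma> a] = fn \<Gamma> f [a]"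
  "fn \<Gamma> f [rep \<Gamma> a, b] = fn \<Gamma> f [a, b]" "fn \<Gamma> f [a, rep \<Gamma> b] = fn \<Gamma> f [a, b]"
  "fn \<Gamma> f [rep \<Gamma> a, b, c] = fn \<Gamma> f [a, b, c]" "fn \<Gamma> f [a, rep \<Gamma> b, c] = fn \<Gamma> f [a, b, c]"
  "fn \<Gamma> f [a, b, rep \<Gamma> c] = fn \<Gamma> f [a, b, c]"
  by (rule fn_cong; simp)+

lemmas drop_rep = succ_rep fn_args

lemma rep_weaken: "rep \<Gamma> s = rep \<Gamma> t \<Longrightarrow> \<Gamma> \<lesssim> \<Delta> \<Longrightarrow> rep \<Delta> s = rep \<Delta> t"
  unfolding Eq_iff[symmetric] by (rule weaken)

lemma succ_not_Zero: "succ \<Gamma> t = rep \<Gamma> Zero \<Longrightarrow> \<Gamma> \<turnstile> p"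
  using Impl_elim[OF HA_axiom[OF HA.Succ_Zero], of \<Gamma> t]
  by (simp add: Bot_elim Eq_iff succ_rep)

lemma succ_inject: "succ \<Gamma> s = succ \<Gamma> t \<Longrightarrow> rep \<Gamma> s = rep \<Gamma> t"
  using Impl_elim[OF HA_axiom[OF HA.Succ_inj], of \<Gamma> s t] by (simp add: Eq_iff succ_rep)

lemma HA_eq: "(s \<^bold>= t) \<in> HA \<Longrightarrow> rep \<Gamma> s = rep \<Gamma> t"
  unfolding Eq_iff[symmetric] by (rule HA_axiom)

lemma fn_PZero [simp]: "fn \<Gamma> PZero ts = rep \<Gamma> Zero"
  unfolding fn_def by (rule HA_eq) (rule HA.PZero)

lemma fn_PSucc [simp]: "fn \<Gamma> PSucc ts = succ \<Gamma> (arg Zero 0 ts)"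
  unfolding fn_def succ_def by (rule HA_eq) (rule HA.PSucc)

lemma fn_PProj [simp]: "fn \<Gamma> (PProj i) ts = rep \<Gamma> (arg Zero i ts)"
  unfolding fn_def by (rule HA_eq) (rule HA.PProj)

lemma fn_PComp [simp]: "fn \<Gamma> (PComp f gs) ts = fn \<Gamma> f (map (\<lambda>g. fn \<Gamma> g ts) gs)"
proof -
  have "fn \<Gamma> (PComp f gs) ts = rep \<Gamma> (Fn f (map (\<lambda>g. Fn g ts) gs))"
    unfolding fn_def by (rule HA_eq) (rule HA.PComp)
  also have "\<dots> = fn \<Gamma> f (map (\<lambda>g. fn \<Gamma> g ts) gs)"
    using fn_rep[of \<Gamma> f "map (\<lambda>g. Fn g ts) gs"] by (simp add: o_def fn_rep)
  finally show ?thesis .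
qed

lemma fn_PRec [simp]: "fn \<Gamma> (PRec f g) (Zero # ts) = fn \<Gamma> f ts"
  "fn \<Gamma> (PRec f g) (rep \<Gamma> Zero # ts) = fn \<Gamma> f ts"
  "fn \<Gamma> (PRec f g) (succ \<Gamma> t # ts) = fn \<Gamma> g (t # fn \<Gamma> (PRec f g) (t # ts) # ts)"
proof -
  show "fn \<Gamma> (PRec f g) (Zero # ts) = fn \<Gamma> f ts"
    unfolding fn_def by (rule HA_eq) (rule HA.PRec_Zero)
  moreover have "fn \<Gamma> (PRec f g) (rep \<Gamma> Zero # ts) = fn \<Gamma> (PRec f g) (Zero # ts)"
    by (rule fn_cong) simp
  ultimately show "fn \<Gamma> (PRec f g) (rep \<Gamma> Zero # ts) = fn \<Gamma> f ts" by simp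
  have "fn \<Gamma> (PRec f g) (succ \<Gamma> t # ts) = fn \<Gamma> (PRec f g) (Succ t # ts)"
    by (rule fn_cong) (simp add: succ_rep)
  also have "\<dots> = fn \<Gamma> g (t # Fn (PRec f g) (t # ts) # ts)"
    unfolding fn_def by (rule HA_eq) (rule HA.PRec_Succ)
  also have "\<dots> = fn \<Gamma> g (t # fn \<Gamma> (PRec f g) (t # ts) # ts)"
    by (rule fn_cong) (simp add: fn_def del: rep_Fn)
  finally show "fn \<Gamma> (PRec f g) (succ \<Gamma> t # ts) = fn \<Gamma> g (t # fn \<Gamma> (PRec f g) (t # ts) # ts)" .
qed

section \<open>Arithmetic\<close>

lemma eq_induct:
  assumes "rep \<Gamma> (sub_tm (Zero \<cdot> Var) l) = rep \<Gamma> (sub_tm (Zero \<cdot> Var) r)"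
    and "\<And>t \<Delta>. \<Gamma> \<lesssim> \<Delta> \<Longrightarrow> rep \<Delta> (sub_tm (t \<cdot> Var) l) = rep \<Delta> (sub_tm (t \<cdot> Var) r) \<Longrightarrow>
      rep \<Delta> (sub_tm (Succ t \<cdot> Var) l) = rep \<Delta> (sub_tm (Succ t \<cdot> Var) r)"
  shows "rep \<Gamma> (sub_tm (t \<cdot> Var) l) = rep \<Gamma> (sub_tm (t \<cdot> Var) r)"
  using induction[of \<Gamma> "l \<^bold>= r" t] assms by (simp add: Eq_iff)

text \<open>Equality with 0 is decidable in Heyting arithmetic, by an induction whose two cases are
  immediate. The case distinctions on whether a computation has halted come from here.\<close>

lemma zero_or_succ:
  assumes "\<And>\<Delta>. \<Gamma> \<lesssim> \<Delta> \<Longrightarrow> rep \<Delta> t = rep \<Delta> Zero \<Longrightarrow> \<Delta> \<turnstile> r"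
    and "\<And>\<Delta> u. \<Gamma> \<lesssim> \<Delta> \<Longrightarrow> rep \<Delta> t = succ \<Delta> (rep \<Delta> u) \<Longrightarrow> \<Delta> \<turnstile> r"
  shows "\<Gamma> \<turnstile> r"
proof -
  let ?p = "Var 0 \<^bold>= Zero \<^bold>\<or> Ex (Var 1 \<^bold>= Succ (Var 0))"
  have "\<Gamma> \<turnstile> sub (t \<cdot> Var) ?p"
  proof (rule induction)
    show "\<Gamma> \<turnstile> sub (Zero \<cdot> Var) ?p"
      by (simp add: Disj_intro1 Eq_refl)
    show "\<Delta> \<turnstile> sub (Succ u \<cdot> Var) ?p" for u \<Delta>
      using Ex_intro[of \<Delta> u "Succ (lift_tm u) \<^bold>= Succ (Var 0)"]
      by (simp add: Disj_intro2 Eq_refl)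
  qed
  then have "\<Gamma> \<turnstile> t \<^bold>= Zero \<^bold>\<or> Ex (lift_tm t \<^bold>= Succ (Var 0))" by simp
  then show ?thesis
  proof (rule Disj_elim)
    show "\<Delta> \<turnstile> r" if "\<Gamma> \<lesssim> \<Delta>" "\<Delta> \<turnstile> t \<^bold>= Zero" for \<Delta>
      using assms(1) that by (simp add: Eq_iff)
    fix \<Delta> assume 1: "\<Gamma> \<lesssim> \<Delta>"
    assume "\<Delta> \<turnstile> Ex (lift_tm t \<^bold>= Succ (Var 0))"
    then show "\<Delta> \<turnstile> r"
    proof (rule Ex_elim)
      show "\<Theta> \<turnstile> r" if "\<Delta> \<lesssim> \<Theta>" "\<Theta> \<turnstile> sub (u \<cdot> Var) (lift_tm t \<^bold>= Succ (Var 0))" for u \<Theta>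
        using assms(2)[OF ext_trans[OF 1 that(1)], of u] that(2) by (simp add: Eq_iff)
    qed
  qed
qed

section \<open>Addition and truncated subtraction\<close>

lemma fn_add [simp]: "fn \<Gamma> pr_add [rep \<Gamma> Zero, b] = rep \<Gamma> b"
  "fn \<Gamma> pr_add [succ \<Gamma> a, b] = succ \<Gamma> (fn \<Gamma> pr_add [a, b])"
  by (simp_all add: pr_add_def)

lemma fn_add_Zero [simp]: "fn \<Gamma> pr_add [a, rep \<Gamma> Zero] = rep \<Gamma> a"
proof -
  have "rep \<Gamma> (sub_tm (a \<cdot> Var) (Fn pr_add [Var 0, Zero])) = rep \<Gamma> (sub_tm (a \<cdot> Var) (Var 0))"
    by (rule eq_induct) simp_all
  then show ?thesis by (simp add: drop_rep)
qed

lemma fn_add_succ [simp]: "fn \<Gamma> pr_add [a, succ \<Gamma> b] = succ \<Gamma> (fn \<Gamma> pr_add [a, b])"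
proof -
  have "rep \<Gamma> (sub_tm (a \<cdot> Var) (Fn pr_add [Var 0, Succ (lift_tm b)])) =
      rep \<Gamma> (sub_tm (a \<cdot> Var) (Succ (Fn pr_add [Var 0, lift_tm b])))"
    by (rule eq_induct) simp_all
  then show ?thesis by (simp add: drop_rep)
qed

lemma fn_add_assoc: "fn \<Gamma> pr_add [fn \<Gamma> pr_add [a, b], c] = fn \<Gamma> pr_add [a, fn \<Gamma> pr_add [b, c]]"
proof -
  have "rep \<Gamma> (sub_tm (a \<cdot> Var) (Fn pr_add [Fn pr_add [Var 0, lift_tm b], lift_tm c])) =
      rep \<Gamma> (sub_tm (a \<cdot> Var) (Fn pr_add [Var 0, Fn pr_add [lift_tm b, lift_tm c]]))"
    by (rule eq_induct) simp_all
  then show ?thesis by (simp add: drop_rep)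
qed

lemma fn_pred [simp]: "fn \<Gamma> pr_pred [succ \<Gamma> a] = rep \<Gamma> a"
  by (simp add: pr_pred_def)

lemma fn_bus [simp]: "fn \<Gamma> pr_bus [rep \<Gamma> Zero, b] = rep \<Gamma> b"
  "fn \<Gamma> pr_bus [succ \<Gamma> a, b] = fn \<Gamma> pr_pred [fn \<Gamma> pr_bus [a, b]]"
  by (simp_all add: pr_bus_def)

text \<open>\<open>pr_bus\<close> takes repeated predecessors of its second argument, so one more
  predecessor cancels a successor there. This is the induction step of
  \<open>fn_bus_add\<close>.\<close>

lemma fn_pred_bus [simp]: "fn \<Gamma> pr_pred [fn \<Gamma> pr_bus [a, succ \<Gamma> b]] = fn \<Gamma> pr_bus [a, b]"
proof -
  have "rep \<Gamma> (sub_tm (a \<cdot> Var) (Fn pr_pred [Fn pr_bus [Var 0, Succ (lift_tm b)]])) =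
      rep \<Gamma> (sub_tm (a \<cdot> Var) (Fn pr_bus [Var 0, lift_tm b]))"
    by (rule eq_induct) simp_all
  then show ?thesis by (simp add: drop_rep)
qed

lemma fn_bus_add [simp]: "fn \<Gamma> pr_bus [a, fn \<Gamma> pr_add [a, b]] = rep \<Gamma> b"
proof -
  have "rep \<Gamma> (sub_tm (a \<cdot> Var) (Fn pr_bus [Var 0, Fn pr_add [Var 0, lift_tm b]])) =
      rep \<Gamma> (sub_tm (a \<cdot> Var) (lift_tm b))"
    by (rule eq_induct) simp_all
  then show ?thesis by (simp add: drop_rep)
qed

lemma fn_bus_self [simp]: "fn \<Gamma> pr_bus [a, a] = rep \<Gamma> Zero"
  using fn_bus_add[of \<Gamma> a "rep \<Gamma> Zero", unfolded fn_add_Zero] by (simp add: drop_rep)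

lemma fn_sub [simp]: "fn \<Gamma> pr_sub [a, b] = fn \<Gamma> pr_bus [b, a]"
  by (simp add: pr_sub_def drop_rep)

lemma fn_dist [simp]:
  "fn \<Gamma> pr_dist [a, b] = fn \<Gamma> pr_add [fn \<Gamma> pr_bus [b, a], fn \<Gamma> pr_bus [a, b]]"
  by (simp add: pr_dist_def)

lemma fn_ifz [simp]: "fn \<Gamma> pr_ifz [rep \<Gamma> Zero, a, b] = rep \<Gamma> a"
  "fn \<Gamma> pr_ifz [succ \<Gamma> c, a, b] = rep \<Gamma> b"
  by (simp_all add: pr_ifz_def)

section \<open>Triangular roots and the projections of a Cantor pair\<close>

lemma fn_tri [simp]: "fn \<Gamma> pr_tri [rep \<Gamma> Zero] = rep \<Gamma> Zero"
  "fn \<Gamma> pr_tri [succ \<Gamma> a] = succ \<Gamma> (fn \<Gamma> pr_add [fn \<Gamma> pr_tri [a], a])"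
  by (simp_all add: pr_tri_def drop_rep)

lemma fn_root [simp]: "fn \<Gamma> pr_root [rep \<Gamma> Zero] = rep \<Gamma> Zero"
  "fn \<Gamma> pr_root [succ \<Gamma> a] = fn \<Gamma> pr_ifz [fn \<Gamma> pr_dist [succ \<Gamma> a, fn \<Gamma> pr_tri [succ \<Gamma> (fn \<Gamma> pr_root [a])]],
     succ \<Gamma> (fn \<Gamma> pr_root [a]), fn \<Gamma> pr_root [a]]"
  by (simp_all add: pr_root_def drop_rep)

text \<open>The witness \<open>c\<close> says that \<open>a < k\<close>. The next triangular number,
  \<open>triangle k + k + 1\<close>, then lies \<open>c + 1\<close> above the new argument
  \<open>triangle k + a + 1\<close>, so the test in the recursion for the root fails and the root
  remains \<open>k\<close>.\<close>

lemma root_tri_add_step: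
  assumes "fn \<Gamma> pr_add [a, succ \<Gamma> c] = rep \<Gamma> k"
    and "fn \<Gamma> pr_root [fn \<Gamma> pr_add [fn \<Gamma> pr_tri [rep \<Gamma> k], rep \<Gamma> a]] = rep \<Gamma> k"
  shows "fn \<Gamma> pr_root [fn \<Gamma> pr_add [fn \<Gamma> pr_tri [rep \<Gamma> k], succ \<Gamma> (rep \<Gamma> a)]] = rep \<Gamma> k"
proof -
  let ?m = "fn \<Gamma> pr_add [fn \<Gamma> pr_tri [rep \<Gamma> k], rep \<Gamma> a]"
  have "fn \<Gamma> pr_add [fn \<Gamma> pr_tri [rep \<Gamma> k], rep \<Gamma> k] = fn \<Gamma> pr_add [?m, succ \<Gamma> c]"
    unfolding fn_add_assoc assms(1)[symmetric] by (simp add: drop_rep)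
  then show ?thesis using assms(2) fn_bus_add[of \<Gamma> ?m "succ \<Gamma> c"]
    by (simp del: fn_bus_add)
qed

lemma root_tri_add:
  assumes "rep \<Gamma> (Fn pr_root [Fn pr_tri [k]]) = rep \<Gamma> k"
    and "rep \<Gamma> (Fn pr_add [a, c]) = rep \<Gamma> k"
  shows "rep \<Gamma> (Fn pr_root [Fn pr_add [Fn pr_tri [k], a]]) = rep \<Gamma> k"
proof -
  let ?k = "lift_tm (lift_tm k)"
  \<comment> \<open>The distance from \<open>a\<close> to \<open>k\<close> is generalized, because
    the hypothesis for \<open>t\<close> is applied at a distance one larger than that of
    \<open>Succ t\<close>.\<close>
  let ?p = "All (Fn pr_add [Var 1, Var 0] \<^bold>= ?k \<^bold>\<longrightarrow>
    Fn pr_root [Fn pr_add [Fn pr_tri [?k], Var 1]] \<^bold>= ?k)"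
  have "\<Gamma> \<turnstile> sub (a \<cdot> Var) ?p"
  proof (rule induction)
    show "\<Gamma> \<turnstile> sub (Zero \<cdot> Var) ?p"
      using rep_weaken[OF assms(1)] by (auto intro!: All_intro Impl_intro simp: Eq_iff)
  next
    fix t \<Delta> assume IH: "\<Delta> \<turnstile> sub (t \<cdot> Var) ?p"
    have "\<Theta> \<turnstile> Fn pr_root [Fn pr_add [Fn pr_tri [k], Succ t]] \<^bold>= k"
      if "\<Delta> \<lesssim> \<Theta>" "\<Theta> \<turnstile> Fn pr_add [Succ t, c] \<^bold>= k" for \<Theta> c
    proof -
      have "\<Theta> \<turnstile> sub (t \<cdot> Var) ?p" using IH that(1) by (rule weaken)
      then have "\<Theta> \<turnstile> Fn pr_add [t, Succ c] \<^bold>= k \<^bold>\<longrightarrow> Fn pr_root [Fn pr_add [Fn pr_tri [k], t]] \<^bold>= k"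
        using All_elim[where t = "Succ c"] by fastforce
      moreover have "\<Theta> \<turnstile> Fn pr_add [t, Succ c] \<^bold>= k"
        using that(2) by (simp add: Eq_iff)
      ultimately have "\<Theta> \<turnstile> Fn pr_root [Fn pr_add [Fn pr_tri [k], t]] \<^bold>= k" by (rule Impl_elim)
      then show ?thesis
        using that(2) root_tri_add_step[of \<Theta> "rep \<Theta> t" "rep \<Theta> c" k] by (simp add: Eq_iff)
    qed
    then show "\<Delta> \<turnstile> sub (Succ t \<cdot> Var) ?p"
      by (auto intro!: All_intro Impl_intro)
  qed
  then have "\<Gamma> \<turnstile> All (Fn pr_add [lift_tm a, Var 0] \<^bold>= lift_tm k \<^bold>\<longrightarrow>
      Fn pr_root [Fn pr_add [Fn pr_tri [lift_tm k], lift_tm a]] \<^bold>= lift_tm k)"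
    by simp
  from All_elim[OF this, of c] have
    "\<Gamma> \<turnstile> Fn pr_add [a, c] \<^bold>= k \<^bold>\<longrightarrow> Fn pr_root [Fn pr_add [Fn pr_tri [k], a]] \<^bold>= k" by simp
  from Impl_elim[OF this] assms(2) show ?thesis unfolding Eq_iff by blast
qed

lemma root_tri: "rep \<Gamma> (Fn pr_root [Fn pr_tri [k]]) = rep \<Gamma> k"
proof -
  have "rep \<Gamma> (sub_tm (k \<cdot> Var) (Fn pr_root [Fn pr_tri [Var 0]])) = rep \<Gamma> (sub_tm (k \<cdot> Var) (Var 0))"
  proof (rule eq_induct)
    fix t \<Delta>
    assume "rep \<Delta> (sub_tm (t \<cdot> Var) (Fn pr_root [Fn pr_tri [Var 0]])) = rep \<Delta> (sub_tm (t \<cdot> Var) (Var 0))"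
    \<comment> \<open>The last argument with root \<open>t\<close>, at distance 0; its successor is
      the next triangular number, where the root goes up.\<close>
    then have "fn \<Delta> pr_root [fn \<Delta> pr_add [fn \<Delta> pr_tri [rep \<Delta> t], rep \<Delta> t]] = rep \<Delta> t"
      using root_tri_add[of \<Delta> t t Zero] by simp
    then show "rep \<Delta> (sub_tm (Succ t \<cdot> Var) (Fn pr_root [Fn pr_tri [Var 0]])) =
        rep \<Delta> (sub_tm (Succ t \<cdot> Var) (Var 0))"
      by simp
  qed simp
  then show ?thesis by simp
qed

lemma fn_pair: "fn \<Gamma> pr_pair [a, b] = fn \<Gamma> pr_add [fn \<Gamma> pr_tri [fn \<Gamma> pr_add [a, b]], a]"
  by (simp add: pr_pair_def drop_rep)

lemma fn_root_pair: "fn \<Gamma> pr_root [fn \<Gamma> pr_pair [a, b]] = fn \<Gamma> pr_add [a, b]"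
  using root_tri_add[OF root_tri refl, of \<Gamma> a b] by (simp add: fn_pair drop_rep)

lemma fn_L_pair [simp]: "fn \<Gamma> pr_L [fn \<Gamma> pr_pair [a, b]] = rep \<Gamma> a"
  unfolding pr_L_def by (simp add: fn_root_pair) (simp add: fn_pair)

lemma fn_R_pair [simp]: "fn \<Gamma> pr_R [fn \<Gamma> pr_pair [a, b]] = rep \<Gamma> b"
  unfolding pr_R_def by (simp add: fn_root_pair drop_rep)

text \<open>Explicit differences are what the comparison of two halting times requires: the later
  state is the earlier one after \<open>d\<close> more steps.\<close>

lemma comparable:
  assumes "\<And>\<Delta> d. \<Gamma> \<lesssim> \<Delta> \<Longrightarrow> rep \<Delta> t = fn \<Delta> pr_add [rep \<Delta> s, rep \<Delta> d] \<Longrightarrow> \<Delta> \<turnstile> r"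
    and "\<And>\<Delta> d. \<Gamma> \<lesssim> \<Delta> \<Longrightarrow> rep \<Delta> s = fn \<Delta> pr_add [rep \<Delta> t, rep \<Delta> d] \<Longrightarrow> \<Delta> \<turnstile> r"
  shows "\<Gamma> \<turnstile> r"
proof -
  let ?t = "lift_tm (lift_tm t)"
  let ?p = "Ex (?t \<^bold>= Fn pr_add [Var 1, Var 0]) \<^bold>\<or> Ex (Var 1 \<^bold>= Fn pr_add [?t, Var 0])"
  have left: "\<Delta> \<turnstile> sub (u \<cdot> Var) ?p" if "\<Delta> \<turnstile> t \<^bold>= Fn pr_add [u, d]" for \<Delta> u d
    using Ex_intro[of \<Delta> d "lift_tm t \<^bold>= Fn pr_add [lift_tm u, Var 0]"] that
    by (simp add: Disj_intro1)
  have right: "\<Delta> \<turnstile> sub (u \<cdot> Var) ?p" if "\<Delta> \<turnstile> u \<^bold>= Fn pr_add [t, d]" for \<Delta> u d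
    using Ex_intro[of \<Delta> d "lift_tm u \<^bold>= Fn pr_add [lift_tm t, Var 0]"] that
    by (simp add: Disj_intro2)
  have elim: "\<Delta> \<turnstile> q" if "\<Delta> \<turnstile> sub (u \<cdot> Var) ?p"
    and 1: "\<And>d \<Theta>. \<Delta> \<lesssim> \<Theta> \<Longrightarrow> \<Theta> \<turnstile> t \<^bold>= Fn pr_add [u, d] \<Longrightarrow> \<Theta> \<turnstile> q"
    and 2: "\<And>d \<Theta>. \<Delta> \<lesssim> \<Theta> \<Longrightarrow> \<Theta> \<turnstile> u \<^bold>= Fn pr_add [t, d] \<Longrightarrow> \<Theta> \<turnstile> q" for \<Delta> u q
  proof -
    from that(1) have "\<Delta> \<turnstile> Ex (lift_tm t \<^bold>= Fn pr_add [lift_tm u, Var 0]) \<^bold>\<or>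
        Ex (lift_tm u \<^bold>= Fn pr_add [lift_tm t, Var 0])" by simp
    then show ?thesis
      by (rule Disj_elim) (erule Ex_elim, auto intro: 1 2 ext_trans)+
  qed
  have "\<Gamma> \<turnstile> sub (s \<cdot> Var) ?p"
  proof (rule induction)
    show "\<Gamma> \<turnstile> sub (Zero \<cdot> Var) ?p"
      by (rule left[of _ _ t]) (simp add: Eq_iff)
    fix u \<Delta>
    assume "\<Delta> \<turnstile> sub (u \<cdot> Var) ?p"
    then show "\<Delta> \<turnstile> sub (Succ u \<cdot> Var) ?p"
    proof (rule elim)
      fix d \<Theta>
      show "\<Theta> \<turnstile> sub (Succ u \<cdot> Var) ?p" if "\<Theta> \<turnstile> u \<^bold>= Fn pr_add [t, d]"
        by (rule right[of _ _ "Succ d"]) (use that in \<open>simp add: Eq_iff\<close>)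
      show "\<Theta> \<turnstile> sub (Succ u \<cdot> Var) ?p" if t: "\<Theta> \<turnstile> t \<^bold>= Fn pr_add [u, d]"
      proof (rule zero_or_succ[of _ d])
        fix \<Theta>' assume "\<Theta> \<lesssim> \<Theta>'"
        then have t': "\<Theta>' \<turnstile> t \<^bold>= Fn pr_add [u, d]" using t weaken by blast
        \<comment> \<open>Here \<open>t = u\<close>, so the order changes sides at
          \<open>Succ u\<close>.\<close>
        show "\<Theta>' \<turnstile> sub (Succ u \<cdot> Var) ?p" if "rep \<Theta>' d = rep \<Theta>' Zero"
          by (rule right[of _ _ "Succ Zero"]) (use t' that in \<open>simp add: Eq_iff\<close>)
        show "\<Theta>' \<turnstile> sub (Succ u \<cdot> Var) ?p" if "rep \<Theta>' d = succ \<Theta>' (rep \<Theta>' v)" for v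
          by (rule left[of _ _ v]) (use t' that in \<open>simp add: Eq_iff\<close>)
      qed
    qed
  qed
  then show ?thesis
    by (rule elim) (use assms in \<open>auto simp: Eq_iff\<close>)
qed

section \<open>Kleene application in the formal system\<close>

lemma fn_step_halted:
  assumes "fn \<Gamma> pr_R [rep \<Gamma> st] = rep \<Gamma> Zero"
  shows "fn \<Gamma> pr_step [st] = rep \<Gamma> st"
proof -
  obtain as where as: "pr_step = pr_if (pr_r (PProj 0)) (PProj 0)
      (pr_switch (pr_l (pr_l (PComp pr_pred [pr_r (PProj 0)]))) as (PProj 0))"
    using pr_step_shape by blast
  show ?thesis unfolding as using assms by simp
qed

lemma fn_state [simp]:
  "fn \<Gamma> pr_state [rep \<Gamma> Zero, e, n] = fn \<Gamma> pr_pair [n, succ \<Gamma> (fn \<Gamma> pr_pair [e, rep \<Gamma> Zero])]"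
  "fn \<Gamma> pr_state [succ \<Gamma> s, e, n] = fn \<Gamma> pr_step [fn \<Gamma> pr_state [s, e, n]]"
  by (simp_all add: pr_state_def drop_rep)

lemma fn_run: "fn \<Gamma> pr_run [s, e, n] = fn \<Gamma> pr_ifz [fn \<Gamma> pr_R [fn \<Gamma> pr_state [s, e, n]],
    succ \<Gamma> (fn \<Gamma> pr_L [fn \<Gamma> pr_state [s, e, n]]), rep \<Gamma> Zero]"
  by (simp add: pr_run_def)

lemma state_halted_add:
  assumes "rep \<Gamma> (Fn pr_R [Fn pr_state [s, e, n]]) = rep \<Gamma> Zero"
  shows "rep \<Gamma> (Fn pr_state [Fn pr_add [s, d], e, n]) = rep \<Gamma> (Fn pr_state [s, e, n])"
proof -
  have "rep \<Gamma> (sub_tm (d \<cdot> Var) (Fn pr_state [Fn pr_add [lift_tm s, Var 0], lift_tm e, lift_tm n])) =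
      rep \<Gamma> (sub_tm (d \<cdot> Var) (Fn pr_state [lift_tm s, lift_tm e, lift_tm n]))"
  proof (rule eq_induct, goal_cases)
    case (2 t \<Delta>)
    then show ?case
      using rep_weaken[OF assms 2(1)] by (simp add: fn_step_halted)
  qed simp
  then show ?thesis by simp
qed

text \<open>\<open>pr_run\<close> returns 0 on a nonempty stack, so a successor value leaves only
  the empty stack; injectivity of the successor then identifies the value.\<close>

lemma run_halted:
  assumes "rep \<Gamma> (Fn pr_run [s, e, n]) = rep \<Gamma> (Succ m)"
  shows "rep \<Gamma> (Fn pr_R [Fn pr_state [s, e, n]]) = rep \<Gamma> Zero"
    and "rep \<Gamma> m = rep \<Gamma> (Fn pr_L [Fn pr_state [s, e, n]])"
proof -
  have "\<Gamma> \<turnstile> Fn pr_R [Fn pr_state [s, e, n]] \<^bold>= Zero"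
  proof (rule zero_or_succ)
    show "\<Delta> \<turnstile> Fn pr_R [Fn pr_state [s, e, n]] \<^bold>= Zero"
      if "\<Gamma> \<lesssim> \<Delta>" "rep \<Delta> (Fn pr_R [Fn pr_state [s, e, n]]) = succ \<Delta> (rep \<Delta> u)" for \<Delta> u
      using rep_weaken[OF assms that(1)] that(2)
      by (intro succ_not_Zero[of \<Delta> "rep \<Delta> m"]) (simp add: fn_run)
  qed (simp add: Eq_iff)
  then show *: "rep \<Gamma> (Fn pr_R [Fn pr_state [s, e, n]]) = rep \<Gamma> Zero" by (simp only: Eq_iff)
  show "rep \<Gamma> m = rep \<Gamma> (Fn pr_L [Fn pr_state [s, e, n]])"
    using assms * succ_inject[of \<Gamma> "rep \<Gamma> m" "fn \<Gamma> pr_L [fn \<Gamma> pr_state [rep \<Gamma> s, rep \<Gamma> e, rep \<Gamma> n]]"]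
    by (simp add: fn_run)
qed

text \<open>A halted state is fixed by further steps, so whichever halting time is later, the state
  there is the one already reached at the earlier time.\<close>

lemma run_functional:
  assumes "rep \<Gamma> (Fn pr_run [s, e, n]) = rep \<Gamma> (Succ m)"
    and "rep \<Gamma> (Fn pr_run [s', e, n]) = rep \<Gamma> (Succ m')"
  shows "rep \<Gamma> m = rep \<Gamma> m'"
proof -
  have "\<Gamma> \<turnstile> m \<^bold>= m'"
  proof (rule comparable[of \<Gamma> s' s])
    fix \<Delta> d
    assume ext: "\<Gamma> \<lesssim> \<Delta>"
    note halted = run_halted[OF rep_weaken[OF assms(1) ext]] run_halted[OF rep_weaken[OF assms(2) ext]]
    show "\<Delta> \<turnstile> m \<^bold>= m'" if "rep \<Delta> s' = fn \<Delta> pr_add [rep \<Delta> s, rep \<Delta> d]"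
      using that halted state_halted_add[OF halted(1), of d] by (simp add: Eq_iff)
    show "\<Delta> \<turnstile> m \<^bold>= m'" if "rep \<Delta> s = fn \<Delta> pr_add [rep \<Delta> s', rep \<Delta> d]"
      using that halted state_halted_add[OF halted(3), of d] by (simp add: Eq_iff)
  qed
  then show ?thesis by (simp only: Eq_iff)
qed

lemma App_intro: "rep \<Gamma> (Fn pr_run [s, e, n]) = rep \<Gamma> (Succ m) \<Longrightarrow> \<Gamma> \<turnstile> App e n m"
  unfolding App_def by (rule Ex_intro[of _ s]) (simp add: Eq_iff)

lemma App_elim:
  assumes "\<Gamma> \<turnstile> App e n m"
    and "\<And>s \<Delta>. \<Gamma> \<lesssim> \<Delta> \<Longrightarrow> rep \<Delta> (Fn pr_run [s, e, n]) = rep \<Delta> (Succ m) \<Longrightarrow> \<Delta> \<turnstile> r"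
  shows "\<Gamma> \<turnstile> r"
  using assms(1) unfolding App_def
  by (rule Ex_elim) (use assms(2) in \<open>simp add: Eq_iff\<close>)

lemma App_functional:
  assumes "\<Gamma> \<turnstile> App e n m" and "\<Gamma> \<turnstile> App e n m'"
  shows "\<Gamma> \<turnstile> m \<^bold>= m'"
proof (rule App_elim[OF assms(1)])
  fix s \<Delta> assume 1: "\<Gamma> \<lesssim> \<Delta>" "rep \<Delta> (Fn pr_run [s, e, n]) = rep \<Delta> (Succ m)"
  show "\<Delta> \<turnstile> m \<^bold>= m'"
  proof (rule App_elim[OF weaken[OF assms(2) 1(1)]])
    fix s' \<Theta> assume "\<Delta> \<lesssim> \<Theta>" "rep \<Theta> (Fn pr_run [s', e, n]) = rep \<Theta> (Succ m')"
    then show "\<Theta> \<turnstile> m \<^bold>= m'"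
      unfolding Eq_iff using run_functional rep_weaken[OF 1(2)] by blast
  qed
qed

lemma at_App_intro: "\<Gamma> \<turnstile> App e n v \<Longrightarrow> \<Gamma> \<turnstile> sub (v \<cdot> Var) p \<Longrightarrow> \<Gamma> \<turnstile> at_App e n p"
  unfolding at_App_def by (rule Ex_intro[of _ v]) simp

lemma at_App_elim:
  assumes "\<Gamma> \<turnstile> at_App e n p"
    and "\<And>v \<Delta>. \<Gamma> \<lesssim> \<Delta> \<Longrightarrow> \<Delta> \<turnstile> App e n v \<Longrightarrow> \<Delta> \<turnstile> sub (v \<cdot> Var) p \<Longrightarrow> \<Delta> \<turnstile> r"
  shows "\<Gamma> \<turnstile> r"
  using assms(1) unfolding at_App_def
  by (rule Ex_elim) (auto intro: assms(2))

text \<open>A tag equal to the number of entries is still a successor at every test, each of which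
  lowers it by one, so no entry is selected.\<close>

lemma fn_switch_default:
  "fn \<Gamma> t ts = rep \<Gamma> ((Succ ^^ length as) Zero) \<Longrightarrow> fn \<Gamma> (pr_switch t as b) ts = fn \<Gamma> b ts"
proof (induct as arbitrary: t)
  case (Cons a as)
  then show ?case using Cons(1)[of "PComp pr_pred [t]"] by simp
qed simp

text \<open>The index \<open>\<langle>11, 0\<rangle>\<close> has an unused tag, so the evaluator never leaves its initial state.\<close>

definition divergent :: tm where
  "divergent = Fn pr_pair [(Succ ^^ 11) Zero, Zero]"

lemma sub_divergent [simp]: "sub_tm \<sigma> divergent = divergent" "lift_tm divergent = divergent"
  by (simp_all add: divergent_def numeral_eq_Suc)

lemma state_divergent:
  "rep \<Gamma> (Fn pr_state [s, divergent, n]) = rep \<Gamma> (Fn pr_pair [n, Succ (Fn pr_pair [divergent, Zero])])"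
proof -
  have "rep \<Gamma> (sub_tm (s \<cdot> Var) (Fn pr_state [Var 0, divergent, lift_tm n])) =
      rep \<Gamma> (sub_tm (s \<cdot> Var) (Fn pr_pair [lift_tm n, Succ (Fn pr_pair [divergent, Zero])]))"
  proof (rule eq_induct, goal_cases)
    case (2 t \<Delta>)
    define d where "d = rep \<Delta> ((Succ ^^ 11) Zero)"
    have d: "rep \<Delta> divergent = fn \<Delta> pr_pair [d, rep \<Delta> Zero]"
      by (simp add: divergent_def d_def)
    obtain as where as: "length as = 11" "pr_step = pr_if (pr_r (PProj 0)) (PProj 0)
        (pr_switch (pr_l (pr_l (PComp pr_pred [pr_r (PProj 0)]))) as (PProj 0))"
      using pr_step_shape by blast
    have "rep \<Delta> d = d" by (simp add: d_def)
    then have "fn \<Delta> pr_step [st] = st"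
      if "st = fn \<Delta> pr_pair [rep \<Delta> n, succ \<Delta> (fn \<Delta> pr_pair [rep \<Delta> divergent, rep \<Delta> Zero])]" for st
      unfolding as(2) by (simp add: that d as(1) fn_switch_default d_def[symmetric])
    then show ?case using 2 by simp
  qed simp
  then show ?thesis by simp
qed

lemma App_divergent: "\<Gamma> \<turnstile> App divergent n m \<Longrightarrow> \<Gamma> \<turnstile> p"
  by (erule App_elim)
    (rule succ_not_Zero, use state_divergent[of _ _ n] in \<open>simp add: fn_run\<close>)

section \<open>Replacement of provably equal terms; rules for membership\<close>

lemma Tru_cong: "\<Gamma> \<turnstile> Tru s \<Longrightarrow> rep \<Gamma> s = rep \<Gamma> t \<Longrightarrow> \<Gamma> \<turnstile> Tru t"
  using Eq_subst[of \<Gamma> s t "Tru (Var 0)"] by (simp add: Eq_iff)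

lemma Mng_cong: "\<Gamma> \<turnstile> Mng s \<Longrightarrow> rep \<Gamma> s = rep \<Gamma> t \<Longrightarrow> \<Gamma> \<turnstile> Mng t"
  using Eq_subst[of \<Gamma> s t "Mng (Var 0)"] by (simp add: Eq_iff)

lemma VSet_cong: "\<Gamma> \<turnstile> VSet s \<Longrightarrow> rep \<Gamma> s = rep \<Gamma> t \<Longrightarrow> \<Gamma> \<turnstile> VSet t"
  using Eq_subst[of \<Gamma> s t "VSet (Var 0)"] by (simp add: Eq_iff)

lemma App_cong: "\<Gamma> \<turnstile> App e n v \<Longrightarrow> rep \<Gamma> n = rep \<Gamma> n' \<Longrightarrow> \<Gamma> \<turnstile> App e n' v"
  using Eq_subst[of \<Gamma> n n' "App (lift_tm e) (Var 0) (lift_tm v)"] by (simp add: Eq_iff)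

lemma sub_cong2:
  assumes "\<Gamma> \<turnstile> sub (a \<cdot> b \<cdot> Var) p" "rep \<Gamma> a = rep \<Gamma> a'" "rep \<Gamma> b = rep \<Gamma> b'"
  shows "\<Gamma> \<turnstile> sub (a' \<cdot> b' \<cdot> Var) p"
proof -
  have "\<Gamma> \<turnstile> sub (a' \<cdot> b \<cdot> Var) p"
    using Eq_subst[of \<Gamma> a a' "sub (Var 0 \<cdot> lift_tm b \<cdot> (\<lambda>i. Var (Suc i))) p"] assms
    by (simp add: Eq_iff)
  then show ?thesis
    using Eq_subst[of \<Gamma> b b' "sub (lift_tm a' \<cdot> Var 0 \<cdot> (\<lambda>i. Var (Suc i))) p"] assms
    by (simp add: Eq_iff)
qed

lemma in_EL_intro:
  "\<Gamma> \<turnstile> App x n v \<Longrightarrow> \<Gamma> \<turnstile> Tru (proj_R v) \<Longrightarrow> rep \<Gamma> a = rep \<Gamma> (proj_L v) \<Longrightarrow> \<Gamma> \<turnstile> in_EL a x"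
  unfolding in_EL_def by (rule Ex_intro[of _ n]) (auto intro!: at_App_intro[of _ _ _ v] simp: Eq_iff)

lemma in_EL_elim:
  assumes "\<Gamma> \<turnstile> in_EL a x"
    and "\<And>n v \<Delta>. \<Gamma> \<lesssim> \<Delta> \<Longrightarrow> \<Delta> \<turnstile> App x n v \<Longrightarrow> \<Delta> \<turnstile> Tru (proj_R v) \<Longrightarrow>
      rep \<Delta> a = rep \<Delta> (proj_L v) \<Longrightarrow> \<Delta> \<turnstile> r"
  shows "\<Gamma> \<turnstile> r"
  using assms(1) unfolding in_EL_def
  by (rule Ex_elim, simp, elim at_App_elim) (auto intro: assms(2) ext_trans simp: Eq_iff)

section \<open>Conditions and v-sets\<close>

lemma ECT_elim:
  assumes "almost_negative p"
    and "\<And>n \<Delta>. \<Gamma> \<lesssim> \<Delta> \<Longrightarrow> \<Delta> \<turnstile> sub (n \<cdot> Var) p \<Longrightarrow> \<Delta> \<turnstile> Ex (sub (up (n \<cdot> Var)) q)"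
    and "\<And>e \<Delta>. \<Gamma> \<lesssim> \<Delta> \<Longrightarrow> (\<And>n \<Theta>. \<Delta> \<lesssim> \<Theta> \<Longrightarrow> \<Theta> \<turnstile> sub (n \<cdot> Var) p \<Longrightarrow>
      \<Theta> \<turnstile> at_App e n (sub (up (n \<cdot> Var)) q)) \<Longrightarrow> \<Delta> \<turnstile> r"
  shows "\<Gamma> \<turnstile> r"
proof -
  have "\<Gamma> \<turnstile> ECT p q"
    by (rule axiom) (use assms(1) in \<open>auto simp: axioms_def\<close>)
  moreover have "\<Gamma> \<turnstile> All (p \<^bold>\<longrightarrow> Ex q)"
    by (auto intro!: All_intro Impl_intro assms(2))
  ultimately have "\<Gamma> \<turnstile> Ex (All (inst [Var 0] 2 p \<^bold>\<longrightarrow>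
      at_App (Var 1) (Var 0) (inst [Var 0, Var 1] 3 q)))"
    unfolding ECT_def by (rule Impl_elim)
  then show ?thesis
  proof (rule Ex_elim)
    fix e \<Delta>
    assume ext: "\<Gamma> \<lesssim> \<Delta>" and e: "\<Delta> \<turnstile> sub (e \<cdot> Var) (All (inst [Var 0] 2 p \<^bold>\<longrightarrow>
      at_App (Var 1) (Var 0) (inst [Var 0, Var 1] 3 q)))"
    have "\<Delta> \<turnstile> sub (n \<cdot> Var) p \<^bold>\<longrightarrow> at_App e n (sub (up (n \<cdot> Var)) q)" for n
      using All_elim[OF e[unfolded sub.simps], of n] by (simp add: up_scons)
    then show "\<Delta> \<turnstile> r"
      using assms(3)[OF ext] weaken Impl_elim by blast
  qed
qed

lemma Mng_intro:
  assumes "\<And>n v \<Delta>. \<Gamma> \<lesssim> \<Delta> \<Longrightarrow> \<Delta> \<turnstile> App f n v \<Longrightarrow> \<Delta> \<turnstile> at_App f n (Mng (Var 0))"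
    and "\<And>n v \<Delta>. \<Gamma> \<lesssim> \<Delta> \<Longrightarrow> \<Delta> \<turnstile> App g n v \<Longrightarrow> \<Delta> \<turnstile> at_App g n (Mng (Var 0))"
  shows "\<Gamma> \<turnstile> Mng (Fn \<Xi> [f, g])"
proof -
  have "\<Gamma> \<turnstile> X2 \<Xi>" by (rule axiom) (simp add: axioms_def)
  from All_elim[OF this[unfolded X2_def], of f, unfolded sub.simps]
  have *: "\<Gamma> \<turnstile> All (defined (lift_tm f) (Var 0) \<^bold>\<longrightarrow> at_App (lift_tm f) (Var 0) (Mng (Var 0))) \<^bold>\<longrightarrow>
     All (at_App (lift_tm f) (Var 0) (Tru (Var 0)) \<^bold>\<and> defined (lift_tm g) (Var 0) \<^bold>\<longrightarrow>
       at_App (lift_tm g) (Var 0) (Mng (Var 0))) \<^bold>\<longrightarrow> Mng (Fn \<Xi> [f, g])"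
    by (drule_tac All_elim[where t = g]) simp
  have f: "\<Delta> \<turnstile> at_App f n (Mng (Var 0))" if "\<Gamma> \<lesssim> \<Delta>" "\<Delta> \<turnstile> defined f n" for n \<Delta>
    using that(2) unfolding defined_def
    by (rule Ex_elim) (auto intro: assms(1) ext_trans[OF that(1)])
  have g: "\<Delta> \<turnstile> at_App g n (Mng (Var 0))" if "\<Gamma> \<lesssim> \<Delta>" "\<Delta> \<turnstile> defined g n" for n \<Delta>
    using that(2) unfolding defined_def
    by (rule Ex_elim) (auto intro: assms(2) ext_trans[OF that(1)])
  show ?thesis
    by (intro Impl_elim[OF Impl_elim[OF *]] All_intro) (auto intro!: Impl_intro intro: f g)
qed

lemma Tru_iff:
  assumes "\<Gamma> \<turnstile> Mng (Fn \<Xi> [f, g])"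
  shows "\<Gamma> \<turnstile> Tru (Fn \<Xi> [f, g]) \<longleftrightarrow> (\<forall>n. \<Gamma> \<turnstile> at_App f n (Tru (Var 0)) \<^bold>\<longrightarrow> at_App g n (Tru (Var 0)))"
proof -
  have "\<Gamma> \<turnstile> X1 \<Xi>" by (rule axiom) (simp add: axioms_def)
  from All_elim[OF this[unfolded X1_def Let_def], of f, unfolded sub.simps]
  have *: "\<Gamma> \<turnstile> Mng (Fn \<Xi> [f, g]) \<^bold>\<longrightarrow> (Tru (Fn \<Xi> [f, g]) \<^bold>\<longrightarrow>
      All (at_App (lift_tm f) (Var 0) (Tru (Var 0)) \<^bold>\<longrightarrow> at_App (lift_tm g) (Var 0) (Tru (Var 0)))) \<^bold>\<and>
      (All (at_App (lift_tm f) (Var 0) (Tru (Var 0)) \<^bold>\<longrightarrow> at_App (lift_tm g) (Var 0) (Tru (Var 0))) \<^bold>\<longrightarrow>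
        Tru (Fn \<Xi> [f, g]))" (is "\<Gamma> \<turnstile> _ \<^bold>\<longrightarrow> (_ \<^bold>\<longrightarrow> ?q) \<^bold>\<and> _")
    by (drule_tac All_elim[where t = g]) simp
  from Impl_elim[OF this assms] have "\<Gamma> \<turnstile> Tru (Fn \<Xi> [f, g]) \<longleftrightarrow> \<Gamma> \<turnstile> ?q"
    by (auto dest: Impl_elim)
  also have "\<dots> \<longleftrightarrow> (\<forall>n. \<Gamma> \<turnstile> at_App f n (Tru (Var 0)) \<^bold>\<longrightarrow> at_App g n (Tru (Var 0)))"
    by (simp add: All_iff)
  finally show ?thesis .
qed

text \<open>\<Xi> of two nowhere defined functions is a condition \<open>T\<close> that is true
  vacuously. With \<open>h\<close> constantly equal to \<open>T\<close>, the condition \<Xi>(h,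
  divergent) is meaningful, but its truth would make \<open>divergent\<close> defined at 0. The
  index \<open>h\<close> is only known to exist, hence the form of an elimination rule.\<close>

lemma false_condition:
  assumes "\<And>F \<Delta>. \<Gamma> \<lesssim> \<Delta> \<Longrightarrow> \<Delta> \<turnstile> Mng F \<Longrightarrow> \<Delta> \<turnstile> Tru F \<^bold>\<longrightarrow> Bot \<Longrightarrow> \<Delta> \<turnstile> r"
  shows "\<Gamma> \<turnstile> r"
proof -
  define T where "T = Fn \<Xi> [divergent, divergent]"
  have T: "\<Delta> \<turnstile> Mng T" "\<Delta> \<turnstile> Tru T" for \<Delta>
  proof -
    show *: "\<Delta> \<turnstile> Mng T"
      unfolding T_def by (rule Mng_intro) (erule App_divergent)+
    show "\<Delta> \<turnstile> Tru T"
      unfolding T_def Tru_iff[OF *[unfolded T_def]]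
      by (auto intro!: Impl_intro elim: at_App_elim intro: App_divergent)
  qed
  show ?thesis
  \<comment> \<open>The trivial domain formula turns \<open>ECT\<close> into Church's thesis, which
    supplies a total function, here a constant one.\<close>
  proof (rule ECT_elim[of "Zero \<^bold>= Zero" _ "Var 0 \<^bold>= lift_tm (lift_tm T)"])
    show "almost_negative (Zero \<^bold>= Zero)"
      by (intro almost_negative.intros sigma1.intros quantifier_free.intros)
    show "\<Delta> \<turnstile> Ex (sub (up (n \<cdot> Var)) (Var 0 \<^bold>= lift_tm (lift_tm T)))" for n \<Delta>
      by (rule Ex_intro[of _ T]) (simp add: Eq_refl)
    fix h \<Delta>
    assume ext: "\<Gamma> \<lesssim> \<Delta>" and "\<And>n \<Theta>. \<Delta> \<lesssim> \<Theta> \<Longrightarrow> \<Theta> \<turnstile> sub (n \<cdot> Var) (Zero \<^bold>= Zero) \<Longrightarrow>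
      \<Theta> \<turnstile> at_App h n (sub (up (n \<cdot> Var)) (Var 0 \<^bold>= lift_tm (lift_tm T)))"
    then have h: "\<Theta> \<turnstile> at_App h n (Var 0 \<^bold>= lift_tm T)" if "\<Delta> \<lesssim> \<Theta>" for n \<Theta>
      using that by (simp add: Eq_refl)
    have M: "\<Delta> \<turnstile> Mng (Fn \<Xi> [h, divergent])"
    proof (rule Mng_intro)
      show "\<Theta> \<turnstile> at_App h n (Mng (Var 0))" if "\<Delta> \<lesssim> \<Theta>" for n \<Theta>
        using h[OF that, of n]
        by (rule at_App_elim) (auto intro!: at_App_intro Mng_cong[OF T(1)] simp: Eq_iff)
    qed (erule App_divergent)
    have "\<Theta> \<turnstile> Bot" if "\<Delta> \<lesssim> \<Theta>" "\<Theta> \<turnstile> Tru (Fn \<Xi> [h, divergent])" for \<Theta>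
    proof -
      have "\<Theta> \<turnstile> at_App h Zero (Tru (Var 0))"
        using h[OF that(1), of Zero]
        by (rule at_App_elim) (auto intro!: at_App_intro Tru_cong[OF T(2)] simp: Eq_iff)
      then have "\<Theta> \<turnstile> at_App divergent Zero (Tru (Var 0))"
        using that(2) Tru_iff[OF weaken[OF M that(1)]] by (blast dest: Impl_elim)
      then show ?thesis by (rule at_App_elim) (erule App_divergent)
    qed
    then show "\<Delta> \<turnstile> r" by (intro assms[OF ext M] Impl_intro)
  qed
qed

abbreviation v_elem :: fm where
  "v_elem \<equiv> Mng (proj_R (Var 0)) \<^bold>\<and> (Tru (proj_R (Var 0)) \<^bold>\<longrightarrow> VSet (proj_L (Var 0)))"

lemma VSet_intro:
  assumes "\<And>n. \<Gamma> \<turnstile> at_App x n v_elem"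
  shows "\<Gamma> \<turnstile> VSet x"
proof -
  have "\<Gamma> \<turnstile> V1" by (rule axiom) (simp add: axioms_def)
  from All_elim[OF this[unfolded V1_def v_closed_def], of x]
  have "\<Gamma> \<turnstile> All (at_App (lift_tm x) (Var 0) v_elem) \<^bold>\<longrightarrow> VSet x" by simp
  then show ?thesis by (rule Impl_elim) (auto intro!: All_intro assms)
qed

text \<open>Inverts (V1) by applying (V2) to the predicate \<open>p\<close>, the conclusion for all
  \<open>n\<close> as a property of \<open>x\<close>. Closure holds because elements with
  \<open>p\<close> are v-sets by (V1), so a set built from them has \<open>p\<close>.\<close>

lemma VSet_elem:
  assumes "\<Gamma> \<turnstile> VSet x"
  shows "\<Gamma> \<turnstile> at_App x n v_elem"
proof -
  define p where "p = All (at_App (Var 1) (Var 0) v_elem)"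
  have p: "\<Delta> \<turnstile> sub (y \<cdot> Var) p \<longleftrightarrow> (\<forall>n. \<Delta> \<turnstile> at_App y n v_elem)" for y \<Delta>
    by (simp add: p_def All_iff)
  have V_p: "\<Delta> \<turnstile> VSet y" if "\<Delta> \<turnstile> sub (y \<cdot> Var) p" for y \<Delta>
    using that by (simp add: p VSet_intro)
  have "\<Gamma> \<turnstile> V2 p" by (rule axiom) (simp add: axioms_def)
  moreover have "\<Gamma> \<turnstile> All (v_closed p 1 (Var 0) \<^bold>\<longrightarrow> p)"
  proof (rule All_intro)
    fix y
    show "\<Gamma> \<turnstile> sub (y \<cdot> Var) (v_closed p 1 (Var 0) \<^bold>\<longrightarrow> p)"
      unfolding sub.simps
    proof (rule Impl_intro)
      fix \<Delta>
      assume "\<Delta> \<turnstile> sub (y \<cdot> Var) (v_closed p 1 (Var 0))"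
      then have *: "\<Delta> \<turnstile> All (at_App (lift_tm y) (Var 0) (Mng (proj_R (Var 0)) \<^bold>\<and>
          (Tru (proj_R (Var 0)) \<^bold>\<longrightarrow> sub (proj_L (Var 0) \<cdot> (\<lambda>i. Var (Suc (Suc i)))) p)))"
        by (simp add: v_closed_def)
      have "\<Delta> \<turnstile> at_App y n v_elem" for n
      proof (rule at_App_elim[OF All_elim[OF *, of n, simplified]])
        fix v \<Theta>
        assume "\<Theta> \<turnstile> App y n v"
          and "\<Theta> \<turnstile> sub (v \<cdot> Var) (Mng (proj_R (Var 0)) \<^bold>\<and>
            (Tru (proj_R (Var 0)) \<^bold>\<longrightarrow> sub (proj_L (Var 0) \<cdot> (\<lambda>i. Var (Suc i))) p))"
        then show "\<Theta> \<turnstile> at_App y n v_elem"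
          by (intro at_App_intro) (auto intro!: Impl_intro V_p intro: Impl_elim[OF weaken])
      qed
      then show "\<Delta> \<turnstile> sub (y \<cdot> Var) p" by (simp add: p)
    qed
  qed
  ultimately have "\<Gamma> \<turnstile> All (VSet (Var 0) \<^bold>\<longrightarrow> p)"
    unfolding V2_def by (rule Impl_elim)
  from All_elim[OF this, of x] have "\<Gamma> \<turnstile> VSet x \<^bold>\<longrightarrow> sub (x \<cdot> Var) p" by simp
  from Impl_elim[OF this assms] show ?thesis by (simp add: p)
qed

section \<open>Images of v-sets under partial recursive functions\<close>

text \<open>The graph that \<open>ECT\<close> makes into a function. The outer existential variable
  is the value of \<open>e\<close>, the inner one the value of \<open>x\<close> at
  \<open>proj_L k\<close>, and \<open>proj_R k\<close> is the number of steps allowed. The conjunct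
  with \<open>Mng\<close> hands on the meaningfulness known from \<open>x\<close>. In the default
  row the element 0 is a dummy, \<open>F\<close> being intended as a false condition.\<close>

definition image_row :: "tm \<Rightarrow> tm \<Rightarrow> tm \<Rightarrow> tm \<Rightarrow> tm \<Rightarrow> fm" where
  "image_row x e F k w =
    (let l = (\<lambda>t. lift_tm (lift_tm t))
     in Ex (Ex (Fn pr_run [proj_R (l k), l e, proj_L (l k)] \<^bold>= Succ (Var 1) \<^bold>\<and>
            App (l x) (proj_L (l k)) (Var 0) \<^bold>\<and> Mng (proj_R (Var 0)) \<^bold>\<and>
            l w \<^bold>= Fn pr_pair [Var 1, proj_R (Var 0)])) \<^bold>\<or>
        Fn pr_run [proj_R k, e, proj_L k] \<^bold>= Zero \<^bold>\<and> w \<^bold>= Fn pr_pair [Zero, F])"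

lemma sub_image_row [simp]: "sub \<sigma> (image_row x e F k w) =
    image_row (sub_tm \<sigma> x) (sub_tm \<sigma> e) (sub_tm \<sigma> F) (sub_tm \<sigma> k) (sub_tm \<sigma> w)"
  by (simp add: image_row_def Let_def)

lemma image_row_elim:
  assumes "\<Gamma> \<turnstile> image_row x e F k w"
    and "\<And>m v \<Delta>. \<Gamma> \<lesssim> \<Delta> \<Longrightarrow> rep \<Delta> (Fn pr_run [proj_R k, e, proj_L k]) = rep \<Delta> (Succ m) \<Longrightarrow>
      \<Delta> \<turnstile> App x (proj_L k) v \<Longrightarrow> \<Delta> \<turnstile> Mng (proj_R v) \<Longrightarrow>
      rep \<Delta> w = rep \<Delta> (Fn pr_pair [m, proj_R v]) \<Longrightarrow> \<Delta> \<turnstile> r"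
    and "\<And>\<Delta>. \<Gamma> \<lesssim> \<Delta> \<Longrightarrow> rep \<Delta> (Fn pr_run [proj_R k, e, proj_L k]) = rep \<Delta> Zero \<Longrightarrow>
      rep \<Delta> w = rep \<Delta> (Fn pr_pair [Zero, F]) \<Longrightarrow> \<Delta> \<turnstile> r"
  shows "\<Gamma> \<turnstile> r"
  using assms(1) unfolding image_row_def Let_def
proof (rule Disj_elim)
  fix \<Delta>
  assume ext: "\<Gamma> \<lesssim> \<Delta>"
  show "\<Delta> \<turnstile> r" if "\<Delta> \<turnstile> Fn pr_run [proj_R k, e, proj_L k] \<^bold>= Zero \<^bold>\<and> w \<^bold>= Fn pr_pair [Zero, F]"
    using assms(3)[OF ext] that by (simp add: Eq_iff)
  assume "\<Delta> \<turnstile> Ex (Ex (Fn pr_run [proj_R (lift_tm (lift_tm k)), lift_tm (lift_tm e),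
        proj_L (lift_tm (lift_tm k))] \<^bold>= Succ (Var 1) \<^bold>\<and>
      App (lift_tm (lift_tm x)) (proj_L (lift_tm (lift_tm k))) (Var 0) \<^bold>\<and> Mng (proj_R (Var 0)) \<^bold>\<and>
      lift_tm (lift_tm w) \<^bold>= Fn pr_pair [Var 1, proj_R (Var 0)]))" (is "_ \<turnstile> Ex (Ex ?body)")
  then show "\<Delta> \<turnstile> r"
  proof (rule Ex_elim, unfold sub.simps(10), elim Ex_elim[where p = "sub (up (_ \<cdot> Var)) ?body"])
    fix m v \<Theta> \<Lambda>
    assume "\<Delta> \<lesssim> \<Theta>" "\<Theta> \<lesssim> \<Lambda>" "\<Lambda> \<turnstile> sub (v \<cdot> Var) (sub (up (m \<cdot> Var)) ?body)"
    then show "\<Lambda> \<turnstile> r"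
      using assms(2)[OF ext_trans[OF ext ext_trans[of _ \<Theta>]], of \<Lambda> m v] by (simp add: Eq_iff)
  qed
qed

text \<open>Halting within a given number of steps is decided by comparing a primitive recursive
  term with 0. In the halted case the condition is read off from \<open>x\<close>, which is total by
  \<open>VSet_elem\<close>.\<close>

lemma image_row_exists:
  assumes "\<Gamma> \<turnstile> VSet x"
  shows "\<Gamma> \<turnstile> Ex (image_row (lift_tm x) (lift_tm e) (lift_tm F) (lift_tm k) (Var 0))"
proof (rule zero_or_succ[of _ "Fn pr_run [proj_R k, e, proj_L k]"])
  fix \<Delta>
  assume ext: "\<Gamma> \<lesssim> \<Delta>"
  show "\<Delta> \<turnstile> Ex (image_row (lift_tm x) (lift_tm e) (lift_tm F) (lift_tm k) (Var 0))"
    if "rep \<Delta> (Fn pr_run [proj_R k, e, proj_L k]) = rep \<Delta> Zero"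
    by (rule Ex_intro[of _ "Fn pr_pair [Zero, F]"])
      (use that in \<open>simp add: image_row_def Let_def Disj_intro2 Eq_iff\<close>)
  fix m
  assume m: "rep \<Delta> (Fn pr_run [proj_R k, e, proj_L k]) = succ \<Delta> (rep \<Delta> m)"
  show "\<Delta> \<turnstile> Ex (image_row (lift_tm x) (lift_tm e) (lift_tm F) (lift_tm k) (Var 0))"
  proof (rule at_App_elim[OF VSet_elem[OF weaken[OF assms ext], of "proj_L k"]])
    fix v \<Theta>
    assume "\<Delta> \<lesssim> \<Theta>" "\<Theta> \<turnstile> App x (proj_L k) v" "\<Theta> \<turnstile> sub (v \<cdot> Var) v_elem"
    then show "\<Theta> \<turnstile> Ex (image_row (lift_tm x) (lift_tm e) (lift_tm F) (lift_tm k) (Var 0))"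
      using rep_weaken[of \<Delta> "Fn pr_run [proj_R k, e, proj_L k]" "Succ m" \<Theta>] m
      unfolding image_row_def Let_def
      by (intro Ex_intro[of _ "Fn pr_pair [m, proj_R v]"], simp, intro Disj_intro1 Ex_intro[of _ m], simp,
          intro Ex_intro[of _ v]) (simp add: Eq_iff)
  qed
qed

text \<open>Since it is undecidable whether \<open>e n\<close> is defined, the image is enumerated by the pairs
  \<open>\<langle>n, s\<rangle>\<close>: if \<open>e n\<close> halts with value \<open>m\<close> after \<open>s\<close> steps, the pair stands for the element \<open>m\<close>
  under the condition of \<open>x\<close> at \<open>n\<close>, and otherwise it carries a false condition.\<close>

lemma image_set:
  assumes x: "\<Gamma> \<turnstile> VSet x"
    and e: "\<And>n v m \<Delta>. \<Gamma> \<lesssim> \<Delta> \<Longrightarrow> \<Delta> \<turnstile> App x n v \<Longrightarrow> \<Delta> \<turnstile> Tru (proj_R v) \<Longrightarrow> \<Delta> \<turnstile> App e n m \<Longrightarrow>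
      \<Delta> \<turnstile> VSet m"
    and cont: "\<And>y \<Delta>. \<Gamma> \<lesssim> \<Delta> \<Longrightarrow> \<Delta> \<turnstile> VSet y \<Longrightarrow>
      (\<And>n v m \<Theta>. \<Delta> \<lesssim> \<Theta> \<Longrightarrow> \<Theta> \<turnstile> App x n v \<Longrightarrow> \<Theta> \<turnstile> Tru (proj_R v) \<Longrightarrow> \<Theta> \<turnstile> App e n m \<Longrightarrow>
        \<Theta> \<turnstile> in_EL m y) \<Longrightarrow>
      (\<And>b q \<Theta>. \<Delta> \<lesssim> \<Theta> \<Longrightarrow> \<Theta> \<turnstile> in_EL b y \<Longrightarrow>
        (\<And>n v \<Lambda>. \<Theta> \<lesssim> \<Lambda> \<Longrightarrow> \<Lambda> \<turnstile> App x n v \<Longrightarrow> \<Lambda> \<turnstile> Tru (proj_R v) \<Longrightarrow> \<Lambda> \<turnstile> App e n b \<Longrightarrow> \<Lambda> \<turnstile> q) \<Longrightarrow>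
        \<Theta> \<turnstile> q) \<Longrightarrow>
      \<Delta> \<turnstile> r"
  shows "\<Gamma> \<turnstile> r"
proof (rule false_condition)
  fix F \<Gamma>'
  assume ext': "\<Gamma> \<lesssim> \<Gamma>'" and F: "\<Gamma>' \<turnstile> Mng F" "\<Gamma>' \<turnstile> Tru F \<^bold>\<longrightarrow> Bot"
  let ?q = "image_row (lift_tm (lift_tm x)) (lift_tm (lift_tm e)) (lift_tm (lift_tm F)) (Var 1) (Var 0)"
  show "\<Gamma>' \<turnstile> r"
  proof (rule ECT_elim[of "Zero \<^bold>= Zero" _ ?q])
    show "almost_negative (Zero \<^bold>= Zero)"
      by (intro almost_negative.intros sigma1.intros quantifier_free.intros)
    show "\<Delta> \<turnstile> Ex (sub (up (k \<cdot> Var)) ?q)" if "\<Gamma>' \<lesssim> \<Delta>" for k \<Delta>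
      using image_row_exists[OF weaken[OF x ext_trans[OF ext' that]]] by simp
    fix y \<Delta>
    assume ext: "\<Gamma>' \<lesssim> \<Delta>" and "\<And>k \<Theta>. \<Delta> \<lesssim> \<Theta> \<Longrightarrow> \<Theta> \<turnstile> sub (k \<cdot> Var) (Zero \<^bold>= Zero) \<Longrightarrow>
      \<Theta> \<turnstile> at_App y k (sub (up (k \<cdot> Var)) ?q)"
    then have y: "\<Theta> \<turnstile> at_App y k (image_row (lift_tm x) (lift_tm e) (lift_tm F) (lift_tm k) (Var 0))"
      if "\<Delta> \<lesssim> \<Theta>" for k \<Theta>
      using that by (simp add: Eq_refl)
    have ext\<Gamma>: "\<Gamma> \<lesssim> \<Delta>" using ext' ext by (rule ext_trans)
    \<comment> \<open>A true \<open>F\<close> is absurd, so every goal follows; this settles each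
      default row whose condition is assumed true.\<close>
    have F': "\<Theta> \<turnstile> q" if "\<Delta> \<lesssim> \<Theta>" "\<Theta> \<turnstile> Tru F" for q \<Theta>
      using weaken[OF F(2) ext_trans[OF ext that(1)]] that(2) by (blast intro: Bot_elim Impl_elim)
    have "\<Delta> \<turnstile> at_App y k v_elem" for k
    proof (rule at_App_elim[OF y[OF ext_refl]])
      fix w \<Theta>
      assume 1: "\<Delta> \<lesssim> \<Theta>" "\<Theta> \<turnstile> App y k w"
        "\<Theta> \<turnstile> sub (w \<cdot> Var) (image_row (lift_tm x) (lift_tm e) (lift_tm F) (lift_tm k) (Var 0))"
      then have "\<Theta> \<turnstile> image_row x e F k w" by simp
      then have "\<Theta> \<turnstile> sub (w \<cdot> Var) v_elem"
      proof (rule image_row_elim)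
        fix \<Lambda> assume 2: "\<Theta> \<lesssim> \<Lambda>"
        note ext\<Lambda> = ext_trans[OF 1(1) 2]
        show "\<Lambda> \<turnstile> sub (w \<cdot> Var) v_elem" if w: "rep \<Lambda> w = rep \<Lambda> (Fn pr_pair [Zero, F])"
        proof -
          have "rep \<Lambda> F = rep \<Lambda> (proj_R w)" using w by simp
          then have "\<Lambda> \<turnstile> Mng (proj_R w)"
            by (rule Mng_cong[OF weaken[OF F(1) ext_trans[OF ext ext\<Lambda>]]])
          moreover have "\<Lambda> \<turnstile> Tru (proj_R w) \<^bold>\<longrightarrow> VSet (proj_L w)"
          proof (rule Impl_intro)
            fix \<Pi>
            assume 3: "\<Lambda> \<lesssim> \<Pi>" "\<Pi> \<turnstile> Tru (proj_R w)"
            have "\<Pi> \<turnstile> Tru F"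
              by (rule Tru_cong[OF 3(2)]) (use rep_weaken[OF w 3(1)] in simp)
            then show "\<Pi> \<turnstile> VSet (proj_L w)"
              by (rule F'[OF ext_trans[OF ext\<Lambda> 3(1)]])
          qed
          ultimately show ?thesis by simp
        qed
        fix m v
        assume m: "rep \<Lambda> (Fn pr_run [proj_R k, e, proj_L k]) = rep \<Lambda> (Succ m)"
          and v: "\<Lambda> \<turnstile> App x (proj_L k) v" "\<Lambda> \<turnstile> Mng (proj_R v)"
          and w: "rep \<Lambda> w = rep \<Lambda> (Fn pr_pair [m, proj_R v])"
        have "\<Lambda> \<turnstile> Mng (proj_R w)"
          by (rule Mng_cong[OF v(2)]) (use w in simp)
        moreover have "\<Lambda> \<turnstile> Tru (proj_R w) \<^bold>\<longrightarrow> VSet (proj_L w)"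
        proof (rule Impl_intro)
          fix \<Pi>
          assume 3: "\<Lambda> \<lesssim> \<Pi>" "\<Pi> \<turnstile> Tru (proj_R w)"
          note w' = rep_weaken[OF w 3(1)]
          have "\<Pi> \<turnstile> Tru (proj_R v)"
            by (rule Tru_cong[OF 3(2)]) (use w' in simp)
          then have "\<Pi> \<turnstile> VSet m"
            using e[OF ext_trans[OF ext\<Gamma> ext_trans[OF ext\<Lambda> 3(1)]] weaken[OF v(1) 3(1)]]
              App_intro[OF rep_weaken[OF m 3(1)]] by blast
          then show "\<Pi> \<turnstile> VSet (proj_L w)"
            by (rule VSet_cong) (use w' in simp)
        qed
        ultimately show "\<Lambda> \<turnstile> sub (w \<cdot> Var) v_elem" by simp
      qed
      with 1(2) show "\<Theta> \<turnstile> at_App y k v_elem" by (rule at_App_intro)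
    qed
    then have "\<Delta> \<turnstile> VSet y" by (rule VSet_intro)
    then show "\<Delta> \<turnstile> r"
    proof (rule cont[OF ext\<Gamma>])
      fix n v m \<Theta>
      assume 1: "\<Delta> \<lesssim> \<Theta>" "\<Theta> \<turnstile> App x n v" "\<Theta> \<turnstile> Tru (proj_R v)" "\<Theta> \<turnstile> App e n m"
      show "\<Theta> \<turnstile> in_EL m y"
      proof (rule App_elim[OF 1(4)])
        fix s \<Lambda>
        assume 2: "\<Theta> \<lesssim> \<Lambda>" and s: "rep \<Lambda> (Fn pr_run [s, e, n]) = rep \<Lambda> (Succ m)"
        \<comment> \<open>The position of \<open>m\<close> in \<open>y\<close>: \<open>s\<close> is
          a number of steps after which \<open>e n\<close> has halted.\<close>
        define k where "k = Fn pr_pair [n, s]"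
        show "\<Lambda> \<turnstile> in_EL m y"
        proof (rule at_App_elim[OF y[OF ext_trans[OF 1(1) 2], of k]])
          fix w \<Pi>
          assume 3: "\<Lambda> \<lesssim> \<Pi>" "\<Pi> \<turnstile> App y k w"
            "\<Pi> \<turnstile> sub (w \<cdot> Var) (image_row (lift_tm x) (lift_tm e) (lift_tm F) (lift_tm k) (Var 0))"
          then have "\<Pi> \<turnstile> image_row x e F k w" by simp
          then show "\<Pi> \<turnstile> in_EL m y"
          proof (rule image_row_elim)
            fix \<Phi> assume 4: "\<Pi> \<lesssim> \<Phi>"
            note ext\<Phi> = ext_trans[OF 2 ext_trans[OF 3(1) 4]]
            note s' = rep_weaken[OF s ext_trans[OF 3(1) 4]]
            show "\<Phi> \<turnstile> in_EL m y" if "rep \<Phi> (Fn pr_run [proj_R k, e, proj_L k]) = rep \<Phi> Zero"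
              by (rule succ_not_Zero[of _ "rep \<Phi> m"]) (use that s' in \<open>simp add: k_def\<close>)
            fix m' v'
            assume m': "rep \<Phi> (Fn pr_run [proj_R k, e, proj_L k]) = rep \<Phi> (Succ m')"
              and v': "\<Phi> \<turnstile> App x (proj_L k) v'"
              and w: "rep \<Phi> w = rep \<Phi> (Fn pr_pair [m', proj_R v'])"
            have "succ \<Phi> (rep \<Phi> m) = succ \<Phi> (rep \<Phi> m')"
              using m' s' by (simp add: k_def)
            from succ_inject[OF this] have "rep \<Phi> m = rep \<Phi> m'" by simp
            moreover have "\<Phi> \<turnstile> App x n v'"
              by (rule App_cong[OF v']) (simp add: k_def)
            \<comment> \<open>The row refers to some value \<open>v'\<close> of \<open>x n\<close>;
              single-valuedness identifies it with \<open>v\<close>, whose condition is known to be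
              true.\<close>
            then have "rep \<Phi> v = rep \<Phi> v'"
              using App_functional[OF weaken[OF 1(2) ext\<Phi>]] by (simp add: Eq_iff)
            moreover from this have "\<Phi> \<turnstile> Tru (proj_R w)"
              by (intro Tru_cong[OF weaken[OF 1(3) ext\<Phi>]]) (use w in simp)
            ultimately show "\<Phi> \<turnstile> in_EL m y"
              using w by (intro in_EL_intro[OF weaken[OF 3(2) 4]]) simp_all
          qed
        qed
      qed
    next
      fix b q \<Theta>
      assume 1: "\<Delta> \<lesssim> \<Theta>" "\<Theta> \<turnstile> in_EL b y"
        and q: "\<And>n v \<Lambda>. \<Theta> \<lesssim> \<Lambda> \<Longrightarrow> \<Lambda> \<turnstile> App x n v \<Longrightarrow> \<Lambda> \<turnstile> Tru (proj_R v) \<Longrightarrow> \<Lambda> \<turnstile> App e n b \<Longrightarrow> \<Lambda> \<turnstile> q"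
      show "\<Theta> \<turnstile> q"
      proof (rule in_EL_elim[OF 1(2)])
        fix k w \<Lambda>
        assume 2: "\<Theta> \<lesssim> \<Lambda>" "\<Lambda> \<turnstile> App y k w" "\<Lambda> \<turnstile> Tru (proj_R w)" "rep \<Lambda> b = rep \<Lambda> (proj_L w)"
        show "\<Lambda> \<turnstile> q"
        proof (rule at_App_elim[OF y[OF ext_trans[OF 1(1) 2(1)], of k]])
          fix w' \<Pi>
          assume 3: "\<Lambda> \<lesssim> \<Pi>" "\<Pi> \<turnstile> App y k w'"
            "\<Pi> \<turnstile> sub (w' \<cdot> Var) (image_row (lift_tm x) (lift_tm e) (lift_tm F) (lift_tm k) (Var 0))"
          \<comment> \<open>\<open>w\<close> comes from membership and \<open>w'\<close> from the
            graph; both are values of \<open>y\<close> at \<open>k\<close>.\<close>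
          have "rep \<Pi> w = rep \<Pi> w'"
            using App_functional[OF weaken[OF 2(2) 3(1)] 3(2)] by (simp add: Eq_iff)
          note eq = rep_weaken[OF this]
          from 3 have "\<Pi> \<turnstile> image_row x e F k w'" by simp
          then show "\<Pi> \<turnstile> q"
          proof (rule image_row_elim)
            fix \<Phi> assume 4: "\<Pi> \<lesssim> \<Phi>"
            note ext\<Phi> = ext_trans[OF 3(1) 4]
            note T = weaken[OF 2(3) ext\<Phi>] and b = rep_weaken[OF 2(4) ext\<Phi>]
            show "\<Phi> \<turnstile> q" if "rep \<Phi> w' = rep \<Phi> (Fn pr_pair [Zero, F])"
              by (rule F'[OF ext_trans[OF 1(1) ext_trans[OF 2(1) ext\<Phi>]] Tru_cong[OF T]])
                (use that eq[OF 4] in simp)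
            fix m v
            assume m: "rep \<Phi> (Fn pr_run [proj_R k, e, proj_L k]) = rep \<Phi> (Succ m)"
              and v: "\<Phi> \<turnstile> App x (proj_L k) v"
              and w: "rep \<Phi> w' = rep \<Phi> (Fn pr_pair [m, proj_R v])"
            show "\<Phi> \<turnstile> q"
            proof (rule q[OF ext_trans[OF 2(1) ext\<Phi>] v])
              show "\<Phi> \<turnstile> Tru (proj_R v)"
                by (rule Tru_cong[OF T]) (use eq[OF 4] w in simp)
              \<comment> \<open>The second component of the position is the halting time.\<close>
              show "\<Phi> \<turnstile> App e (proj_L k) b"
                by (rule App_intro[of _ "proj_R k"]) (use m b eq[OF 4] w in simp)
            qed
          qed
        qed
      qed
    qed
  qed
qed

text \<open>\<open>total\<close> speaks of elements, the conclusion of positions. Two positions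
  naming the same element may receive different values, which is why the outcome is collection and
  not a choice function on sets.\<close>

lemma choice_function:
  assumes x: "\<Gamma> \<turnstile> VSet x"
    and total: "\<And>a \<Delta>. \<Gamma> \<lesssim> \<Delta> \<Longrightarrow> \<Delta> \<turnstile> in_EL a x \<Longrightarrow> \<Delta> \<turnstile> Ex (sub (lift_tm a \<cdot> Var 0 \<cdot> (\<lambda>i. Var (Suc i))) p)"
    and cont: "\<And>e \<Delta>. \<Gamma> \<lesssim> \<Delta> \<Longrightarrow>
      (\<And>n v \<Theta>. \<Delta> \<lesssim> \<Theta> \<Longrightarrow> \<Theta> \<turnstile> App x n v \<Longrightarrow> \<Theta> \<turnstile> Tru (proj_R v) \<Longrightarrow>
        \<Theta> \<turnstile> at_App e n (sub (lift_tm (proj_L v) \<cdot> Var 0 \<cdot> (\<lambda>i. Var (Suc i))) p)) \<Longrightarrow> \<Delta> \<turnstile> r"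
  shows "\<Gamma> \<turnstile> r"
proof -
  \<comment> \<open>Membership in \<open>EL(x)\<close> is not almost negative, but as \<open>x n\<close> is always defined, the
    truth of \<open>cd\<^sub>x(n)\<close> can be expressed by a universal quantifier over its val.\<close>
  let ?p = "All (App (lift_tm (lift_tm x)) (Var 1) (Var 0) \<^bold>\<longrightarrow> Tru (proj_R (Var 0)))"
  \<comment> \<open>\<open>ECT\<close> provides \<open>n\<close>, whereas \<open>p\<close> needs the
    element at \<open>n\<close>, so the relation first evaluates \<open>x n\<close>. Inside,
    variable 0 is that value, 1 the number sought, 2 is \<open>n\<close>, and the parameters begin
    at 3.\<close>
  let ?q = "at_App (lift_tm (lift_tm x)) (Var 1) (sub (proj_L (Var 0) \<cdot> Var 1 \<cdot> (\<lambda>i. Var (i + 3))) p)"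
  show ?thesis
  proof (rule ECT_elim[of ?p _ ?q])
    show "almost_negative ?p"
      unfolding App_def
      by (intro almost_negative.intros(4,6,7) almost_negative.intros(1)[OF sigma1.intros(2)]
          sigma1.intros(1) quantifier_free.intros)
    fix n \<Delta>
    assume ext: "\<Gamma> \<lesssim> \<Delta>" and "\<Delta> \<turnstile> sub (n \<cdot> Var) ?p"
    then have T: "\<Delta> \<turnstile> App x n v \<^bold>\<longrightarrow> Tru (proj_R v)" for v
      by (simp add: All_iff)
    show "\<Delta> \<turnstile> Ex (sub (up (n \<cdot> Var)) ?q)"
    proof (rule at_App_elim[OF VSet_elem[OF weaken[OF x ext], of n]])
      fix v \<Theta>
      assume 1: "\<Delta> \<lesssim> \<Theta>" "\<Theta> \<turnstile> App x n v"
      have "\<Theta> \<turnstile> in_EL (proj_L v) x"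
        using in_EL_intro[OF 1(2) Impl_elim[OF weaken[OF T 1(1)] 1(2)]] by blast
      from total[OF ext_trans[OF ext 1(1)] this] show "\<Theta> \<turnstile> Ex (sub (up (n \<cdot> Var)) ?q)"
      proof (rule Ex_elim)
        fix m \<Lambda>
        assume "\<Theta> \<lesssim> \<Lambda>" "\<Lambda> \<turnstile> sub (m \<cdot> Var) (sub (lift_tm (proj_L v) \<cdot> Var 0 \<cdot> (\<lambda>i. Var (Suc i))) p)"
        then show "\<Lambda> \<turnstile> Ex (sub (up (n \<cdot> Var)) ?q)"
          by (intro Ex_intro[of _ m]) (simp add: at_App_intro[OF weaken[OF 1(2)]])
      qed
    qed
  next
    fix e \<Delta>
    assume ext: "\<Gamma> \<lesssim> \<Delta>"
      and e: "\<And>n \<Theta>. \<Delta> \<lesssim> \<Theta> \<Longrightarrow> \<Theta> \<turnstile> sub (n \<cdot> Var) ?p \<Longrightarrow> \<Theta> \<turnstile> at_App e n (sub (up (n \<cdot> Var)) ?q)"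
    show "\<Delta> \<turnstile> r"
    proof (rule cont[OF ext])
      fix n v \<Theta>
      assume 1: "\<Delta> \<lesssim> \<Theta>" "\<Theta> \<turnstile> App x n v" "\<Theta> \<turnstile> Tru (proj_R v)"
      \<comment> \<open>The passage from one true value to the universal domain formula: any other
        value \<open>v'\<close> is provably equal to \<open>v\<close>.\<close>
      have "\<Theta> \<turnstile> App x n v' \<^bold>\<longrightarrow> Tru (proj_R v')" for v'
      proof (rule Impl_intro)
        fix \<Lambda> assume "\<Theta> \<lesssim> \<Lambda>" "\<Lambda> \<turnstile> App x n v'"
        then show "\<Lambda> \<turnstile> Tru (proj_R v')"
          using App_functional[of \<Lambda> x n v v'] weaken[OF 1(2)]
          by (intro Tru_cong[OF weaken[OF 1(3)]]) (simp_all add: Eq_iff)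
      qed
      then have "\<Theta> \<turnstile> sub (n \<cdot> Var) ?p" by (simp add: All_iff)
      from e[OF 1(1) this]
      show "\<Theta> \<turnstile> at_App e n (sub (lift_tm (proj_L v) \<cdot> Var 0 \<cdot> (\<lambda>i. Var (Suc i))) p)"
      proof (rule at_App_elim)
        fix m \<Lambda>
        assume 2: "\<Theta> \<lesssim> \<Lambda>" "\<Lambda> \<turnstile> App e n m" "\<Lambda> \<turnstile> sub (m \<cdot> Var) (sub (up (n \<cdot> Var)) ?q)"
        then have "\<Lambda> \<turnstile> at_App x n (sub (proj_L (Var 0) \<cdot> lift_tm m \<cdot> (\<lambda>i. Var (Suc i))) p)"
          by simp
        then have "\<Lambda> \<turnstile> sub (proj_L v \<cdot> m \<cdot> Var) p"
        proof (rule at_App_elim)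
          fix v' \<Pi>
          assume 3: "\<Lambda> \<lesssim> \<Pi>" "\<Pi> \<turnstile> App x n v'"
            "\<Pi> \<turnstile> sub (v' \<cdot> Var) (sub (proj_L (Var 0) \<cdot> lift_tm m \<cdot> (\<lambda>i. Var (Suc i))) p)"
          have "rep \<Pi> v' = rep \<Pi> v"
            using App_functional[OF 3(2) weaken[OF 1(2) ext_trans[OF 2(1) 3(1)]]] by (simp add: Eq_iff)
          with 3(3) show "\<Pi> \<turnstile> sub (proj_L v \<cdot> m \<cdot> Var) p"
            using sub_cong2[of \<Pi> "proj_L v'" m p "proj_L v" m] by simp
        qed
        then show "\<Lambda> \<turnstile> at_App e n (sub (lift_tm (proj_L v) \<cdot> Var 0 \<cdot> (\<lambda>i. Var (Suc i))) p)"
          using 2(2) by (intro at_App_intro) simp_all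
      qed
    qed
  qed
qed

text \<open>Each value of \<open>e\<close> at a true position is related to the element of
  \<open>x\<close> at that position. Following positions from \<open>x\<close> to \<open>y\<close>
  gives the first clause, following them back gives the second.\<close>

lemma strong_collection:
  assumes x: "\<Gamma> \<turnstile> VSet x"
    and total: "\<And>a \<Delta>. \<Gamma> \<lesssim> \<Delta> \<Longrightarrow> \<Delta> \<turnstile> in_EL a x \<Longrightarrow>
      \<Delta> \<turnstile> Ex (VSet (Var 0) \<^bold>\<and> sub (lift_tm a \<cdot> Var 0 \<cdot> (\<lambda>i. Var (Suc i))) p)"
    and cont: "\<And>y \<Delta>. \<Gamma> \<lesssim> \<Delta> \<Longrightarrow> \<Delta> \<turnstile> VSet y \<Longrightarrow>
      (\<And>a \<Theta>. \<Delta> \<lesssim> \<Theta> \<Longrightarrow> \<Theta> \<turnstile> in_EL a x \<Longrightarrow>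
        \<Theta> \<turnstile> Ex (in_EL (Var 0) (lift_tm y) \<^bold>\<and> sub (lift_tm a \<cdot> Var 0 \<cdot> (\<lambda>i. Var (Suc i))) p)) \<Longrightarrow>
      (\<And>b \<Theta>. \<Delta> \<lesssim> \<Theta> \<Longrightarrow> \<Theta> \<turnstile> in_EL b y \<Longrightarrow>
        \<Theta> \<turnstile> Ex (in_EL (Var 0) (lift_tm x) \<^bold>\<and> sub (Var 0 \<cdot> lift_tm b \<cdot> (\<lambda>i. Var (Suc i))) p)) \<Longrightarrow>
      \<Delta> \<turnstile> r"
  shows "\<Gamma> \<turnstile> r"
\<comment> \<open>That the chosen value is a v-set is made part of the relation;
  \<open>Var 1\<close> is its second argument.\<close>
proof (rule choice_function[OF x, of "VSet (Var 1) \<^bold>\<and> p"])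
  show "\<Delta> \<turnstile> Ex (sub (lift_tm a \<cdot> Var 0 \<cdot> (\<lambda>i. Var (Suc i))) (VSet (Var 1) \<^bold>\<and> p))"
    if "\<Gamma> \<lesssim> \<Delta>" "\<Delta> \<turnstile> in_EL a x" for a \<Delta>
    using total[OF that] by simp
  fix e \<Delta>
  assume ext: "\<Gamma> \<lesssim> \<Delta>" and "\<And>n v \<Theta>. \<Delta> \<lesssim> \<Theta> \<Longrightarrow> \<Theta> \<turnstile> App x n v \<Longrightarrow> \<Theta> \<turnstile> Tru (proj_R v) \<Longrightarrow>
    \<Theta> \<turnstile> at_App e n (sub (lift_tm (proj_L v) \<cdot> Var 0 \<cdot> (\<lambda>i. Var (Suc i))) (VSet (Var 1) \<^bold>\<and> p))"
  then have e: "\<Theta> \<turnstile> at_App e n (VSet (Var 0) \<^bold>\<and> sub (lift_tm (proj_L v) \<cdot> Var 0 \<cdot> (\<lambda>i. Var (Suc i))) p)"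
    if "\<Delta> \<lesssim> \<Theta>" "\<Theta> \<turnstile> App x n v" "\<Theta> \<turnstile> Tru (proj_R v)" for n v \<Theta>
    using that by simp
  \<comment> \<open>\<open>e\<close> supplies some suitable value of \<open>e n\<close>;
    single-valuedness extends the property to every \<open>m\<close> that is a value.\<close>
  have val: "\<Theta> \<turnstile> VSet m \<and> \<Theta> \<turnstile> sub (proj_L v \<cdot> m \<cdot> Var) p"
    if "\<Delta> \<lesssim> \<Theta>" "\<Theta> \<turnstile> App x n v" "\<Theta> \<turnstile> Tru (proj_R v)" "\<Theta> \<turnstile> App e n m" for n v m \<Theta>
  proof -
    have "\<Theta> \<turnstile> VSet m \<^bold>\<and> sub (proj_L v \<cdot> m \<cdot> Var) p"
    proof (rule at_App_elim[OF e[OF that(1-3)]])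
      fix m' \<Lambda>
      assume 1: "\<Theta> \<lesssim> \<Lambda>" "\<Lambda> \<turnstile> App e n m'" "\<Lambda> \<turnstile> sub (m' \<cdot> Var)
        (VSet (Var 0) \<^bold>\<and> sub (lift_tm (proj_L v) \<cdot> Var 0 \<cdot> (\<lambda>i. Var (Suc i))) p)"
      have "rep \<Lambda> m' = rep \<Lambda> m"
        using App_functional[OF 1(2) weaken[OF that(4) 1(1)]] by (simp add: Eq_iff)
      with 1(3) show "\<Lambda> \<turnstile> VSet m \<^bold>\<and> sub (proj_L v \<cdot> m \<cdot> Var) p"
        using VSet_cong[of \<Lambda> m' m] sub_cong2[of \<Lambda> "proj_L v" m' p "proj_L v" m] by simp
    qed
    then show ?thesis by simp
  qed
  show "\<Delta> \<turnstile> r"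
  proof (rule image_set[OF weaken[OF x ext]])
    show "\<Theta> \<turnstile> VSet m"
      if "\<Delta> \<lesssim> \<Theta>" "\<Theta> \<turnstile> App x n v" "\<Theta> \<turnstile> Tru (proj_R v)" "\<Theta> \<turnstile> App e n m" for n v m \<Theta>
      using val[OF that] by blast
    fix y \<Theta>
    assume ext\<Theta>: "\<Delta> \<lesssim> \<Theta>" and y: "\<Theta> \<turnstile> VSet y"
      and into: "\<And>n v m \<Lambda>. \<Theta> \<lesssim> \<Lambda> \<Longrightarrow> \<Lambda> \<turnstile> App x n v \<Longrightarrow> \<Lambda> \<turnstile> Tru (proj_R v) \<Longrightarrow> \<Lambda> \<turnstile> App e n m \<Longrightarrow>
        \<Lambda> \<turnstile> in_EL m y"
      and from_y: "\<And>b q \<Lambda>. \<Theta> \<lesssim> \<Lambda> \<Longrightarrow> \<Lambda> \<turnstile> in_EL b y \<Longrightarrow>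
        (\<And>n v \<Pi>. \<Lambda> \<lesssim> \<Pi> \<Longrightarrow> \<Pi> \<turnstile> App x n v \<Longrightarrow> \<Pi> \<turnstile> Tru (proj_R v) \<Longrightarrow> \<Pi> \<turnstile> App e n b \<Longrightarrow> \<Pi> \<turnstile> q) \<Longrightarrow>
        \<Lambda> \<turnstile> q"
    show "\<Theta> \<turnstile> r"
    proof (rule cont[OF ext_trans[OF ext ext\<Theta>] y])
      fix a \<Lambda>
      assume 1: "\<Theta> \<lesssim> \<Lambda>" "\<Lambda> \<turnstile> in_EL a x"
      from 1(2) show "\<Lambda> \<turnstile> Ex (in_EL (Var 0) (lift_tm y) \<^bold>\<and> sub (lift_tm a \<cdot> Var 0 \<cdot> (\<lambda>i. Var (Suc i))) p)"
      proof (rule in_EL_elim)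
        fix n v \<Pi>
        assume 2: "\<Lambda> \<lesssim> \<Pi>" "\<Pi> \<turnstile> App x n v" "\<Pi> \<turnstile> Tru (proj_R v)" "rep \<Pi> a = rep \<Pi> (proj_L v)"
        note ext\<Pi> = ext_trans[OF 1(1) 2(1)]
        show "\<Pi> \<turnstile> Ex (in_EL (Var 0) (lift_tm y) \<^bold>\<and> sub (lift_tm a \<cdot> Var 0 \<cdot> (\<lambda>i. Var (Suc i))) p)"
        proof (rule at_App_elim[OF e[OF ext_trans[OF ext\<Theta> ext\<Pi>] 2(2,3)]])
          fix m \<Phi>
          assume 3: "\<Pi> \<lesssim> \<Phi>" "\<Phi> \<turnstile> App e n m"
          note xv = weaken[OF 2(2) 3(1)] weaken[OF 2(3) 3(1)]
          have "\<Phi> \<turnstile> sub (a \<cdot> m \<cdot> Var) p"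
            using val[OF ext_trans[OF ext\<Theta> ext_trans[OF ext\<Pi> 3(1)]] xv 3(2)]
              rep_weaken[OF 2(4) 3(1)] sub_cong2[of \<Phi> "proj_L v" m p a m] by simp
          then show "\<Phi> \<turnstile> Ex (in_EL (Var 0) (lift_tm y) \<^bold>\<and> sub (lift_tm a \<cdot> Var 0 \<cdot> (\<lambda>i. Var (Suc i))) p)"
            using into[OF ext_trans[OF ext\<Pi> 3(1)] xv 3(2)] by (intro Ex_intro[of _ m]) simp
        qed
      qed
    next
      fix b \<Lambda>
      assume 1: "\<Theta> \<lesssim> \<Lambda>" "\<Lambda> \<turnstile> in_EL b y"
      then show "\<Lambda> \<turnstile> Ex (in_EL (Var 0) (lift_tm x) \<^bold>\<and> sub (Var 0 \<cdot> lift_tm b \<cdot> (\<lambda>i. Var (Suc i))) p)"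
      proof (rule from_y)
        fix n v \<Pi>
        assume 2: "\<Lambda> \<lesssim> \<Pi>" "\<Pi> \<turnstile> App x n v" "\<Pi> \<turnstile> Tru (proj_R v)" "\<Pi> \<turnstile> App e n b"
        show "\<Pi> \<turnstile> Ex (in_EL (Var 0) (lift_tm x) \<^bold>\<and> sub (Var 0 \<cdot> lift_tm b \<cdot> (\<lambda>i. Var (Suc i))) p)"
          using val[OF ext_trans[OF ext\<Theta> ext_trans[OF 1(1) 2(1)]] 2(2-4)] in_EL_intro[OF 2(2,3) refl]
          by (intro Ex_intro[of _ "proj_L v"]) simp
      qed
    qed
  qed
qed

end

theorem theorem8:
  fixes \<Xi> :: pfun and \<psi> :: fm
  assumes "inj (\<lambda>(f, g). pr_eval \<Xi> [f, g])"
  shows "provable \<Xi>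
    (All_set
      (Ball_set (Var 0) (Ex_set (inst [Var 1, Var 0] 3 \<psi>)) \<^bold>\<longrightarrow>
       Ex_set
        (Ball_set (Var 1) (Bex_set (Var 1) (inst [Var 1, Var 0] 4 \<psi>)) \<^bold>\<and>
         Ball_set (Var 0) (Bex_set (Var 2) (inst [Var 0, Var 1] 4 \<psi>)))))"
proof -
  interpret vset_system \<Xi> .
  \<comment> \<open>The claim with its set quantifiers unfolded. Each binder shifts
    \<open>x\<close>: it is 1 below \<open>a\<close>, 2 below \<open>y\<close> and \<open>a\<close>,
    and 3 below \<open>y\<close>, \<open>b\<close> and the source sought for \<open>b\<close>. The
    offsets 3 and 4 of \<open>inst\<close> count the binders in front of the parameters of
    \<psi>.\<close>
  have "[] \<turnstile> All (VSet (Var 0) \<^bold>\<longrightarrow>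
      All (in_EL (Var 0) (Var 1) \<^bold>\<longrightarrow> Ex (VSet (Var 0) \<^bold>\<and> inst [Var 1, Var 0] 3 \<psi>)) \<^bold>\<longrightarrow>
      Ex (VSet (Var 0) \<^bold>\<and>
        All (in_EL (Var 0) (Var 2) \<^bold>\<longrightarrow> Ex (in_EL (Var 0) (Var 2) \<^bold>\<and> inst [Var 1, Var 0] 4 \<psi>)) \<^bold>\<and>
        All (in_EL (Var 0) (Var 1) \<^bold>\<longrightarrow> Ex (in_EL (Var 0) (Var 3) \<^bold>\<and> inst [Var 0, Var 1] 4 \<psi>))))"
  proof (rule All_intro, unfold sub.simps, intro Impl_intro)
    fix x \<Gamma> \<Delta>
    assume x: "\<Gamma> \<turnstile> VSet (sub_tm (x \<cdot> Var) (Var 0))" and ext: "\<Gamma> \<lesssim> \<Delta>"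
      and H: "\<Delta> \<turnstile> All (sub (up (x \<cdot> Var)) (in_EL (Var 0) (Var 1)) \<^bold>\<longrightarrow>
        Ex (VSet (sub_tm (up (up (x \<cdot> Var))) (Var 0)) \<^bold>\<and> sub (up (up (x \<cdot> Var))) (inst [Var 1, Var 0] 3 \<psi>)))"
    have x': "\<Delta> \<turnstile> VSet x" using weaken[OF x ext] by simp
    have total: "\<Theta> \<turnstile> Ex (VSet (Var 0) \<^bold>\<and> sub (lift_tm a \<cdot> Var 0 \<cdot> (\<lambda>i. Var (Suc i))) \<psi>)"
      if "\<Delta> \<lesssim> \<Theta>" "\<Theta> \<turnstile> in_EL a x" for a \<Theta>
      using Impl_elim[OF weaken[OF All_elim[OF H, of a, unfolded sub.simps] that(1)]] that(2)
      by simp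
    show "\<Delta> \<turnstile> Ex (VSet (sub_tm (up (x \<cdot> Var)) (Var 0)) \<^bold>\<and>
        All (sub (up (up (x \<cdot> Var))) (in_EL (Var 0) (Var 2)) \<^bold>\<longrightarrow>
          Ex (sub (up (up (up (x \<cdot> Var)))) (in_EL (Var 0) (Var 2)) \<^bold>\<and>
            sub (up (up (up (x \<cdot> Var)))) (inst [Var 1, Var 0] 4 \<psi>))) \<^bold>\<and>
        All (sub (up (up (x \<cdot> Var))) (in_EL (Var 0) (Var 1)) \<^bold>\<longrightarrow>
          Ex (sub (up (up (up (x \<cdot> Var)))) (in_EL (Var 0) (Var 3)) \<^bold>\<and>
            sub (up (up (up (x \<cdot> Var)))) (inst [Var 0, Var 1] 4 \<psi>))))" (is "\<Delta> \<turnstile> ?r")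
    proof (rule strong_collection[OF x' total])
      fix y \<Theta>
      assume y: "\<Delta> \<lesssim> \<Theta>" "\<Theta> \<turnstile> VSet y"
        "\<And>a \<Lambda>. \<Theta> \<lesssim> \<Lambda> \<Longrightarrow> \<Lambda> \<turnstile> in_EL a x \<Longrightarrow>
          \<Lambda> \<turnstile> Ex (in_EL (Var 0) (lift_tm y) \<^bold>\<and> sub (lift_tm a \<cdot> Var 0 \<cdot> (\<lambda>i. Var (Suc i))) \<psi>)"
        "\<And>b \<Lambda>. \<Theta> \<lesssim> \<Lambda> \<Longrightarrow> \<Lambda> \<turnstile> in_EL b y \<Longrightarrow>
          \<Lambda> \<turnstile> Ex (in_EL (Var 0) (lift_tm x) \<^bold>\<and> sub (Var 0 \<cdot> lift_tm b \<cdot> (\<lambda>i. Var (Suc i))) \<psi>)"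
      show "\<Theta> \<turnstile> ?r"
        by (rule Ex_intro[of _ y]) (use y in \<open>auto intro!: Impl_intro simp: All_iff\<close>)
    qed
  qed
  then show ?thesis
    by (simp add: provable_def prv_def All_set_def Ball_set_def Ex_set_def Bex_set_def numeral_eq_Suc)
qed

end
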